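(* Let $d\ge 1$, let $G$ be a $(d+1)$-connected graph with $n$ vertices and $m$ edges, and suppose that $H$ is a $K_{d+1}$ subgraph of $G$. Then the set $\mathrm{Gstr}$ of general position $d$-dimensional stress matrices for $G$ is irreducible, of dimension $m-\binom{d+1}{2}$, and is parameterized by a Zariski open subset of $\mathbb{R}^{m-\binom{d+1}{2}}$, representing the weights on the edges of $G\setminus H$ (the edges of $G$ not contained in $H$), under a rational map. That is, there are a Zariski open subset $U\subseteq\mathbb{R}^{m-\binom{d+1}{2}}$ (coordinates indexed by the edges of $G$ not in $H$) and a rational map $\rho$ defined on all of $U$ with $\rho(U)=\mathrm{Gstr}$, such that for every $w\in U$ the matrix $\rho(w)$ has edge weight $w_{ij}$ on each edge $\{i,j\}$ of $G$ not in $H$.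
   Context: Graphs are finite and simple, with vertex set $\{1,\dots,n\}$. A graph is $k$-connected if it has at least $k+1$ vertices and remains connected after deleting any set of fewer than $k$ vertices; so here $n\ge d+2$. $\mathrm{Gstr}$ is the set of real symmetric $n\times n$ matrices $\Omega$ such that $\Omega_{ij}=0$ whenever $i\ne j$ and $\{i,j\}$ is not an edge of $G$; the all-ones vector is in the kernel of $\Omega$; $\operatorname{rank}\Omega=n-d-1$; and every subset of $n-d-1$ columns of $\Omega$ is linearly independent. The edge weight of $\Omega$ on an edge $\{i,j\}$ is $\omega_{ij}=-\Omega_{ij}$. Algebraic sets in $\mathbb{R}^N$ are the common zero sets of finitely many polynomials; a Zariski open subset of a set is obtained by removing an algebraic set. An algebraic set is irreducible if it is not the union of two proper algebraic subsets; a semi-algebraic set is irreducible if its Zariski closure is. The dimension of a real semi-algebraic set is the largest $t$ such that some Euclidean-open subset of it is a smooth $t$-dimensional submanifold. *)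

theory Defs
  imports "HOL-Analysis.Analysis" "HOL-Library.Ramsey"
begin

section \<open>Graphs\<close>

text \<open>
  The vertex set is a finite type 'v, so n is CARD('v). An edge set is a set of two-element
  sets of vertices; nsets A 2 is the edge set of the complete graph on A.
\<close>

definition simple_graph :: "'v::finite set set \<Rightarrow> bool" where
  "simple_graph E \<longleftrightarrow> E \<subseteq> nsets UNIV 2"

definition connected_after_deleting :: "'v::finite set set \<Rightarrow> 'v set \<Rightarrow> bool" where
  "connected_after_deleting E X \<longleftrightarrow>
     (\<forall>u v. u \<notin> X \<longrightarrow> v \<notin> X \<longrightarrow>
        (u, v) \<in> {(x, y). x \<notin> X \<and> y \<notin> X \<and> {x, y} \<in> E}\<^sup>*)"

definition k_connected :: "nat \<Rightarrow> 'v::finite set set \<Rightarrow> bool" where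
  "k_connected k E \<longleftrightarrow>
     k + 1 \<le> CARD('v) \<and> (\<forall>X. card X < k \<longrightarrow> connected_after_deleting E X)"


section \<open>General position stress matrices\<close>

text \<open>
  Linear independence of the columns indexed by J is that of the family: the columns are
  pairwise distinct and form an independent set. Without injectivity, repeated columns
  would be collapsed.
\<close>

definition independent_columns :: "real^'v^'v \<Rightarrow> 'v::finite set \<Rightarrow> bool" where
  "independent_columns M J \<longleftrightarrow>
     inj_on (\<lambda>j. column j M) J \<and> independent ((\<lambda>j. column j M) ` J)"

text \<open>
  The numeral 1 in the type of vectors is the all-ones vector. The truncated subtraction
  is harmless when d + 2 is at most CARD('v), as for every (d+1)-connected graph.
\<close>

definition Gstr :: "nat \<Rightarrow> 'v::finite set set \<Rightarrow> (real^'v^'v) set" where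
  "Gstr d E = {M.
     transpose M = M \<and>
     (\<forall>i j. i \<noteq> j \<longrightarrow> {i, j} \<notin> E \<longrightarrow> M $ i $ j = 0) \<and>
     M *v 1 = 0 \<and>
     rank M = CARD('v) - d - 1 \<and>
     (\<forall>J. card J = CARD('v) - d - 1 \<longrightarrow> independent_columns M J)}"

definition edge_weight :: "real^'v^'v \<Rightarrow> 'v::finite \<Rightarrow> 'v \<Rightarrow> real" where
  "edge_weight M i j = - M $ i $ j"


section \<open>Algebraic sets\<close>

text \<open>
  On a Euclidean space, the members of real_polynomial_function are exactly the
  polynomials in the coordinates.
\<close>

definition algebraic_set :: "'a::euclidean_space set \<Rightarrow> bool" where
  "algebraic_set A \<longleftrightarrow>
     (\<exists>F. finite F \<and> (\<forall>f\<in>F. real_polynomial_function f) \<and> A = {x. \<forall>f\<in>F. f x = 0})"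

definition zariski_open_in :: "'a::euclidean_space set \<Rightarrow> 'a set \<Rightarrow> bool" where
  "zariski_open_in X U \<longleftrightarrow> (\<exists>A. algebraic_set A \<and> U = X - A)"

text \<open>
  The intersection below is itself an algebraic set, by Hilbert's basis theorem.
\<close>

definition zariski_closure :: "'a::euclidean_space set \<Rightarrow> 'a set" where
  "zariski_closure S = \<Inter>{A. algebraic_set A \<and> S \<subseteq> A}"

definition irreducible_algebraic :: "'a::euclidean_space set \<Rightarrow> bool" where
  "irreducible_algebraic A \<longleftrightarrow>
     \<not> (\<exists>B C. algebraic_set B \<and> algebraic_set C \<and> B \<subset> A \<and> C \<subset> A \<and> A = B \<union> C)"

definition irreducible_semialgebraic :: "'a::euclidean_space set \<Rightarrow> bool" where
  "irreducible_semialgebraic S \<longleftrightarrow> irreducible_algebraic (zariski_closure S)"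

text \<open>
  A rational map defined on all of U: each coordinate is a quotient of two polynomials whose
  denominator has no zero on U.
\<close>

definition rational_map_on ::
  "'a::euclidean_space set \<Rightarrow> ('a \<Rightarrow> 'b::euclidean_space) \<Rightarrow> bool" where
  "rational_map_on U f \<longleftrightarrow>
     (\<forall>b\<in>Basis. \<exists>p q. real_polynomial_function p \<and> real_polynomial_function q \<and>
        (\<forall>x\<in>U. q x \<noteq> 0 \<and> f x \<bullet> b = p x / q x))"


section \<open>Smooth submanifolds and dimension\<close>

fun times_differentiable_on ::
  "nat \<Rightarrow> 'a::euclidean_space set \<Rightarrow> ('a \<Rightarrow> 'b::euclidean_space) \<Rightarrow> bool" where
  "times_differentiable_on 0 S f \<longleftrightarrow> continuous_on S f"
| "times_differentiable_on (Suc k) S f \<longleftrightarrow>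
     (\<forall>x\<in>S. f differentiable (at x)) \<and>
     (\<forall>v. times_differentiable_on k S (\<lambda>x. frechet_derivative f (at x) v))"

definition smooth_map_on ::
  "'a::euclidean_space set \<Rightarrow> ('a \<Rightarrow> 'b::euclidean_space) \<Rightarrow> bool" where
  "smooth_map_on S f \<longleftrightarrow> open S \<and> (\<forall>k. times_differentiable_on k S f)"

text \<open>
  Embedded submanifolds, by slice charts: near each point a diffeomorphism between open sets
  of the ambient space flattens M to a t-dimensional linear subspace.
\<close>

definition smooth_submanifold :: "nat \<Rightarrow> 'a::euclidean_space set \<Rightarrow> bool" where
  "smooth_submanifold t M \<longleftrightarrow>
     (\<forall>p\<in>M. \<exists>U (V :: 'a set) L \<phi> \<psi>.
        p \<in> U \<and> homeomorphism U V \<phi> \<psi> \<and> smooth_map_on U \<phi> \<and> smooth_map_on V \<psi> \<and>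
        subspace L \<and> dim L = t \<and> \<phi> ` (U \<inter> M) = V \<inter> L)"

text \<open>
  Nonemptiness is required because the empty set is a submanifold of every dimension. In
  particular the empty set has no dimension.
\<close>

definition has_open_submanifold :: "'a::euclidean_space set \<Rightarrow> nat \<Rightarrow> bool" where
  "has_open_submanifold S t \<longleftrightarrow>
     (\<exists>M. M \<noteq> {} \<and> openin (top_of_set S) M \<and> smooth_submanifold t M)"

definition has_semialgebraic_dim :: "'a::euclidean_space set \<Rightarrow> nat \<Rightarrow> bool" where
  "has_semialgebraic_dim S t \<longleftrightarrow>
     has_open_submanifold S t \<and> (\<forall>t'. has_open_submanifold S t' \<longrightarrow> t' \<le> t)"


section \<open>Weight spaces\<close>

text \<open>
  The space of real vectors with coordinates indexed by the edges in F, realised as the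
  coordinate subspace of vectors indexed by all sets of vertices that vanish outside F. The
  polynomials in the F-coordinates are the restrictions of polynomials on the whole space.
\<close>

definition weight_space :: "'v::finite set set \<Rightarrow> (real^('v set)) set" where
  "weight_space F = {w. \<forall>e. e \<notin> F \<longrightarrow> w $ e = 0}"

end

theory Submission
  imports Defs
begin

text \<open>
  Fix the clique S and let the rows through the n - d - 1 remaining vertices be called free.
  A stress matrix of rank n - d - 1 whose free columns are independent has an invertible free
  principal block C, so it equals (L P) C^{-1} (P L), where P L is the submatrix of free rows.
  These rows are those of the weighted Laplacian of the edges outside S, the diagonal being
  determined by the zero row sums. So the weights outside S determine the stress matrix
  rationally, and general position becomes the non-vanishing of finitely many minors of P L,
  one for each set X of d + 1 deleted columns.

  The minor of X is not identically zero: by Hall's theorem, (d+1)-connectivity gives a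
  matching between the complements of S and X along edges or fixed points, hence disjoint
  paths joining S and X, which extend to a partition of the graph into connected pieces that
  each contain one vertex of S and one of X. Weight 1 inside the pieces and 0 between them
  makes the minor non-zero.

  Irreducibility follows by clearing denominators along the parameterization, and the
  dimension from a global slice chart together with invariance of domain.
\<close>

section \<open>Partitions of highly connected graphs\<close>

text \<open>Halmos-Vaughan induction on the size of \<open>I\<close>. If some nonempty proper subset
  is tight, it and its complement are matched separately, the latter avoiding the neighbours of the
  former. Otherwise an arbitrary pair \<open>a\<close>, \<open>b\<close> can be matched
  first.\<close>

lemma hall_marriage:
  assumes "finite I" "\<And>i. i \<in> I \<Longrightarrow> finite (N i)"
    and "\<And>R. R \<subseteq> I \<Longrightarrow> card R \<le> card (\<Union>(N ` R))"
  shows "\<exists>f. inj_on f I \<and> (\<forall>i\<in>I. f i \<in> N i)"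
  using assms
proof (induction "card I" arbitrary: I N rule: less_induct)
  case (less I N)
  show ?case
  proof (cases "\<exists>R. R \<noteq> {} \<and> R \<subset> I \<and> card (\<Union>(N ` R)) = card R")
    case True
    then obtain R where R: "R \<noteq> {}" "R \<subset> I" "card (\<Union>(N ` R)) = card R" by blast
    have finR: "finite R" using R less.prems(1) finite_subset by blast
    have finNR: "finite (\<Union>(N ` R))" using R less.prems(2) finR by blast
    have "\<exists>f. inj_on f R \<and> (\<forall>i\<in>R. f i \<in> N i)"
      using R less.prems by (intro less.hyps psubset_card_mono finR) auto
    then obtain f where f: "inj_on f R" "\<forall>i\<in>R. f i \<in> N i" by blast
    let ?N = "\<lambda>i. N i - \<Union>(N ` R)"
    have "\<exists>g. inj_on g (I - R) \<and> (\<forall>i\<in>I - R. g i \<in> ?N i)"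
    proof (intro less.hyps)
      show "card (I - R) < card I" using R less.prems(1) by (intro psubset_card_mono) auto
      show "finite (I - R)" using less.prems(1) by simp
      show "finite (?N i)" if "i \<in> I - R" for i using less.prems(2) that by simp
      fix Q assume Q: "Q \<subseteq> I - R"
      have fQ: "finite Q" using Q less.prems(1) finite_subset by blast
      have fNQ: "finite (\<Union>(N ` Q))" using Q less.prems(2) fQ by blast
      \<comment> \<open>Hall's condition for \<open>Q \<union> R\<close>, minus the equality for the
        tight set \<open>R\<close>, is the condition for \<open>Q\<close> in the reduced
        family.\<close>
      have "card (Q \<union> R) = card Q + card R"
        using Q fQ finR by (intro card_Un_disjoint) auto
      moreover have "card (Q \<union> R) \<le> card (\<Union>(N ` (Q \<union> R)))"
        using Q R by (intro less.prems) auto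
      moreover have "\<Union>(N ` (Q \<union> R)) = \<Union>(?N ` Q) \<union> \<Union>(N ` R)" by auto
      moreover have "card (\<Union>(?N ` Q) \<union> \<Union>(N ` R)) = card (\<Union>(?N ` Q)) + card (\<Union>(N ` R))"
        by (intro card_Un_disjoint finNR) (use fNQ in \<open>auto intro: finite_subset[rotated]\<close>)
      ultimately show "card Q \<le> card (\<Union>(?N ` Q))" using R by simp
    qed
    then obtain g where g: "inj_on g (I - R)" "\<forall>i\<in>I - R. g i \<in> ?N i" by blast
    let ?h = "\<lambda>i. if i \<in> R then f i else g i"
    have sep: "f i \<noteq> g j" if "i \<in> R" "j \<in> I - R" for i j
    proof -
      have "f i \<in> \<Union>(N ` R)" using f(2) that(1) by auto
      moreover have "g j \<notin> \<Union>(N ` R)" using g(2) that(2) by auto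
      ultimately show ?thesis by metis
    qed
    have "inj_on ?h I"
    proof (rule inj_onI)
      fix i j assume ij: "i \<in> I" "j \<in> I" "?h i = ?h j"
      show "i = j"
      proof (cases "i \<in> R"; cases "j \<in> R")
        assume "i \<in> R" "j \<in> R" then show ?thesis using ij f(1) by (simp add: inj_on_def)
      next
        assume "i \<in> R" "j \<notin> R" then show ?thesis using ij sep[of i j] by simp
      next
        assume "i \<notin> R" "j \<in> R" then show ?thesis using ij sep[of j i] by simp
      next
        assume "i \<notin> R" "j \<notin> R" then show ?thesis using ij g(1) by (simp add: inj_on_def)
      qed
    qed
    moreover have "\<forall>i\<in>I. ?h i \<in> N i" using f g by auto
    ultimately show ?thesis by blast
  next
    case False
    show ?thesis
    proof (cases "I = {}")
      case True
      then show ?thesis by simp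
    next
      case ne: False
      then obtain a where a: "a \<in> I" by blast
      have "card {a} \<le> card (\<Union>(N ` {a}))" using a by (intro less.prems) auto
      then obtain b where b: "b \<in> N a" by fastforce
      let ?N = "\<lambda>i. N i - {b}"
      have "\<exists>g. inj_on g (I - {a}) \<and> (\<forall>i\<in>I - {a}. g i \<in> ?N i)"
      proof (intro less.hyps)
        show "card (I - {a}) < card I" using a less.prems(1) by (intro psubset_card_mono) auto
        show "finite (I - {a})" using less.prems(1) by simp
        show "finite (?N i)" if "i \<in> I - {a}" for i using less.prems(2) that by simp
        fix Q assume Q: "Q \<subseteq> I - {a}"
        show "card Q \<le> card (\<Union>(?N ` Q))"
        proof (cases "Q = {}")
          case False
          have "card Q \<le> card (\<Union>(N ` Q))" using Q by (intro less.prems) auto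
          \<comment> \<open>Without tight subsets \<open>Q\<close> has a neighbour to spare, which
            pays for the loss of \<open>b\<close>.\<close>
          moreover have "card Q \<noteq> card (\<Union>(N ` Q))"
          proof -
            have "Q \<subset> I" using Q a by blast
            with False \<open>\<not> (\<exists>R. R \<noteq> {} \<and> R \<subset> I \<and> card (\<Union>(N ` R)) = card R)\<close>
            show ?thesis by metis
          qed
          moreover have "\<Union>(?N ` Q) = \<Union>(N ` Q) - {b}" by auto
          moreover have "card (\<Union>(N ` Q)) - card {b} \<le> card (\<Union>(N ` Q) - {b})"
            by (rule diff_card_le_card_Diff) simp
          ultimately show ?thesis by simp
        qed simp
      qed
      then obtain g where g: "inj_on g (I - {a})" "\<forall>i\<in>I - {a}. g i \<in> ?N i" by blast
      have "inj_on (g(a := b)) I"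
        using g by (auto simp: inj_on_def)
      moreover have "\<forall>i\<in>I. (g(a := b)) i \<in> N i" using g b by auto
      ultimately show ?thesis by blast
    qed
  qed
qed

text \<open>\<open>B\<close> separates \<open>R\<close> from the remaining vertices: if it were
  smaller than \<open>k\<close>, some path avoiding \<open>B\<close> would lead out of
  \<open>R\<close>, yet edges leave \<open>R\<close> only into \<open>B\<close>.\<close>

lemma closed_set_k_connected:
  fixes E :: "'v::finite set set"
  assumes "k_connected k E" "R \<noteq> {}" "R \<union> B \<noteq> UNIV" "R \<inter> B = {}"
    and "\<And>u v. u \<in> R \<Longrightarrow> {u, v} \<in> E \<Longrightarrow> v \<in> R \<union> B"
  shows "k \<le> card B"
proof (rule ccontr)
  assume "\<not> k \<le> card B"
  then have "connected_after_deleting E B"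
    using assms(1) by (simp add: k_connected_def)
  moreover obtain u v where uv: "u \<in> R" "v \<notin> R \<union> B" using assms(2,3) by blast
  ultimately have "(u, v) \<in> {(x, y). x \<notin> B \<and> y \<notin> B \<and> {x, y} \<in> E}\<^sup>*"
    using assms(4) by (auto simp: connected_after_deleting_def)
  then have "v \<in> R"
    by induction (use uv(1) assms(5) in blast)+
  with uv show False by simp
qed

text \<open>Hall's condition holds because a set \<open>R\<close> off \<open>S\<close> gains at
  least \<open>k\<close> vertices from its outer boundary \<open>B\<close>, which offsets the
  removal of \<open>X\<close>. Fixed points let a vertex outside both sets be bypassed.\<close>

lemma k_connected_matching:
  fixes E :: "'v::finite set set"
  assumes "k_connected k E" "card S = k" "card X = k"
  shows "\<exists>\<sigma>. bij_betw \<sigma> (- S) (- X) \<and> (\<forall>t\<in>- S. \<sigma> t \<noteq> t \<longrightarrow> {t, \<sigma> t} \<in> E)"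
proof -
  let ?N = "\<lambda>t. {v. v = t \<or> {t, v} \<in> E} - X"
  have cardc: "card (- S) = card (- X)"
    using assms by (simp add: Compl_eq_Diff_UNIV card_Diff_subset)
  have "\<exists>f. inj_on f (- S) \<and> (\<forall>t\<in>- S. f t \<in> ?N t)"
  proof (rule hall_marriage)
    fix R assume R: "R \<subseteq> - S"
    define B where "B = {v. \<exists>t\<in>R. {t, v} \<in> E} - R"
    have un: "\<Union>(?N ` R) = (R \<union> B) - X" by (auto simp: B_def)
    show "card R \<le> card (\<Union>(?N ` R))"
    \<comment> \<open>When \<open>R \<union> B\<close> is everything there is nothing to separate,
      but then the available targets are all of \<open>- X\<close>, as numerous as
      \<open>- S\<close>.\<close>
    proof (cases "R = {} \<or> R \<union> B = UNIV")
      case True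
      then show ?thesis
        using card_mono[OF _ R] cardc unfolding un by (auto simp: Compl_eq_Diff_UNIV)
    next
      case False
      then have "k \<le> card B"
        by (intro closed_set_k_connected[OF assms(1), of R]) (auto simp: B_def)
      moreover have "card (R \<union> B) = card R + card B"
        by (intro card_Un_disjoint) (auto simp: B_def)
      moreover have "card (R \<union> B) - card X \<le> card (R \<union> B - X)"
        by (rule diff_card_le_card_Diff) simp
      ultimately show ?thesis unfolding un using assms by linarith
    qed
  qed auto
  then obtain f where f: "inj_on f (- S)" "\<forall>t\<in>- S. f t \<in> ?N t" by blast
  have "f ` (- S) = - X"
    using f cardc by (intro card_subset_eq) (auto simp: card_image)
  with f show ?thesis by (auto simp: bij_betw_def)
qed

text \<open>
  Following a perfect matching between the complements of S and X from a vertex of X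
  yields a path that ends in S; distinct starting points give disjoint paths.
\<close>

lemma k_connected_disjoint_paths:
  fixes E :: "'v::finite set set"
  assumes "k_connected k E" "card S = k" "card X = k"
  shows "\<exists>W c. S \<subseteq> W \<and> X \<subseteq> W \<and> (\<forall>x\<in>X. c x = x) \<and> c ` W \<subseteq> X \<and> inj_on c S \<and>
    (\<forall>v\<in>W. (c v, v) \<in> {(a, b). a \<in> W \<and> b \<in> W \<and> {a, b} \<in> E \<and> c a = c b}\<^sup>*)"
proof -
  obtain \<sigma> where \<sigma>: "bij_betw \<sigma> (- S) (- X)" "\<And>t. t \<notin> S \<Longrightarrow> \<sigma> t \<noteq> t \<Longrightarrow> {t, \<sigma> t} \<in> E"
    using k_connected_matching[OF assms] by auto
  \<comment> \<open>No arrow of \<open>r\<close> starts in \<open>S\<close> or ends in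
    \<open>X\<close>, and arrows are unique in both directions; the components are paths and cycles,
    the fixed points of \<open>\<sigma>\<close> being loops.\<close>
  define r where "r = {(t, \<sigma> t) | t. t \<notin> S}"
  have r_single: "single_valued r" "single_valued (r\<inverse>)"
    using \<sigma>(1) by (auto simp: r_def single_valued_def bij_betw_def inj_on_def)
  have r_image: "v \<notin> X" if "(u, v) \<in> r" for u v
    using that \<sigma>(1) by (auto simp: r_def bij_betw_def)
  have start_end: "x = v" if "(v, x) \<in> r\<^sup>*" "x \<in> X" for v x
    using that by (cases rule: rtranclE) (auto dest: r_image)
  \<comment> \<open>Two backward walks from \<open>v\<close> follow the same arrows, so one of
    \<open>x\<close>, \<open>y\<close> reaches the other; as no arrow ends in \<open>X\<close>, they
    coincide.\<close>
  have uniq: "x = y" if "(x, v) \<in> r\<^sup>*" "(y, v) \<in> r\<^sup>*" "x \<in> X" "y \<in> X" for x y v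
  proof -
    have "(v, x) \<in> (r\<inverse>)\<^sup>*" "(v, y) \<in> (r\<inverse>)\<^sup>*" using that by (simp_all add: rtrancl_converseI)
    then have "(x, y) \<in> (r\<inverse>)\<^sup>* \<or> (y, x) \<in> (r\<inverse>)\<^sup>*"
      using single_valued_confluent[OF r_single(2)] by blast
    then show ?thesis using that start_end by (metis rtrancl_converseD)
  qed
  have ex_end: "\<exists>s\<in>S. (x, s) \<in> r\<^sup>*" if x: "x \<in> X" for x
  proof (rule ccontr)
    assume "\<not> ?thesis"
    then have sub: "r\<^sup>* `` {x} \<subseteq> - S" by auto
    \<comment> \<open>Pigeonhole: a forward orbit missing \<open>S\<close> would be mapped by the
      injective \<open>\<sigma>\<close> into itself without \<open>x\<close>.\<close>
    have "\<sigma> ` (r\<^sup>* `` {x}) \<subseteq> r\<^sup>* `` {x} - {x}"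
    proof
      fix v assume "v \<in> \<sigma> ` (r\<^sup>* `` {x})"
      then obtain u where u: "(x, u) \<in> r\<^sup>*" "v = \<sigma> u" by auto
      then have "(u, v) \<in> r" using sub by (auto simp: r_def)
      with u x r_image show "v \<in> r\<^sup>* `` {x} - {x}" by (auto intro: rtrancl_into_rtrancl)
    qed
    then have "card (\<sigma> ` (r\<^sup>* `` {x})) \<le> card (r\<^sup>* `` {x} - {x})" by (intro card_mono) auto
    moreover have "card (\<sigma> ` (r\<^sup>* `` {x})) = card (r\<^sup>* `` {x})"
      using \<sigma>(1) sub by (intro card_image) (auto simp: bij_betw_def intro: inj_on_subset)
    moreover have "card (r\<^sup>* `` {x} - {x}) < card (r\<^sup>* `` {x})"
      by (intro psubset_card_mono) auto
    ultimately show False by simp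
  qed
  have s_end: "v = s" if "(s, v) \<in> r\<^sup>*" "s \<in> S" for s v
    using that by (cases rule: converse_rtranclE) (auto simp: r_def)
  define W where "W = r\<^sup>* `` X"
  \<comment> \<open>The start of the path through \<open>v\<close>; the description is determined
    only for \<open>v\<close> in \<open>W\<close>.\<close>
  define c where "c v = (THE x. x \<in> X \<and> (x, v) \<in> r\<^sup>*)" for v
  have c_eq: "c v = x" if "x \<in> X" "(x, v) \<in> r\<^sup>*" for x v
    unfolding c_def using that by (intro the_equality) (auto dest: uniq)
  obtain e where e: "\<And>x. x \<in> X \<Longrightarrow> e x \<in> S \<and> (x, e x) \<in> r\<^sup>*" using ex_end by metis
  have ce: "c (e x) = x" if "x \<in> X" for x using e[OF that] c_eq[OF that] by blast
  \<comment> \<open>The end-point map \<open>e\<close> is injective with left inverse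
    \<open>c\<close>, so by counting it reaches all of \<open>S\<close>; this makes \<open>c\<close>
    injective there.\<close>
  have "inj_on e X" by (rule inj_on_inverseI[of _ c]) (rule ce)
  then have eX: "e ` X = S"
    using assms e by (intro card_subset_eq) (auto simp: card_image)
  have "(c v, v) \<in> {(a, b). a \<in> W \<and> b \<in> W \<and> {a, b} \<in> E \<and> c a = c b}\<^sup>*" if v: "v \<in> W" for v
  proof -
    obtain x where x: "x \<in> X" "(x, v) \<in> r\<^sup>*" using v unfolding W_def by blast
    have "(x, v) \<in> {(a, b). a \<in> W \<and> b \<in> W \<and> {a, b} \<in> E \<and> c a = c b}\<^sup>*"
      using x(2)
    proof induction
      case (step u v)
      have "u \<in> W" "v \<in> W" "c u = x" "c v = x"
        using step x(1) c_eq by (auto simp: W_def intro: rtrancl_into_rtrancl)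
      \<comment> \<open>A loop of \<open>r\<close> adds no edge: the walk has reached
        \<open>v\<close> already.\<close>
      moreover have "u = v \<or> {u, v} \<in> E" using step(2) \<sigma>(2) by (force simp: r_def)
      ultimately show ?case using step(3) by (auto intro: rtrancl_into_rtrancl)
    qed simp
    then show ?thesis using c_eq x by simp
  qed
  moreover have "S \<subseteq> W" using eX e by (auto simp: W_def)
  moreover have "inj_on c S" using eX ce by (auto simp: inj_on_def)
  moreover have "c ` W \<subseteq> X" using c_eq by (auto simp: W_def)
  moreover have "X \<subseteq> W" by (auto simp: W_def)
  moreover have "\<forall>x\<in>X. c x = x" using c_eq by auto
  ultimately show ?thesis by blast
qed

text \<open>Start from the disjoint paths and let connected pieces cover as many vertices as
  possible. They cover everything: otherwise an edge leaving \<open>W\<close> lets its outer end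
  join the piece of its inner end. The map \<open>c\<close> names a piece by its element of
  \<open>X\<close>.\<close>

lemma k_connected_partition:
  fixes E :: "'v::finite set set"
  assumes "k_connected k E" "card S = k" "card X = k" "k \<ge> 1"
  obtains c where "\<And>x. x \<in> X \<Longrightarrow> c x = x" "range c \<subseteq> X" "inj_on c S"
    "\<And>v. (c v, v) \<in> {(a, b). {a, b} \<in> E \<and> c a = c b}\<^sup>*"
proof -
  define P where "P W c \<longleftrightarrow> S \<subseteq> W \<and> X \<subseteq> W \<and> (\<forall>x\<in>X. c x = x) \<and> c ` W \<subseteq> X \<and> inj_on c S \<and>
    (\<forall>v\<in>W. (c v, v) \<in> {(a, b). a \<in> W \<and> b \<in> W \<and> {a, b} \<in> E \<and> c a = c b}\<^sup>*)" for W c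
  have ex: "\<exists>W. \<exists>c. P W c" using k_connected_disjoint_paths[OF assms(1-3)] by (simp add: P_def)
  define W where "W = (ARG_MAX card W. \<exists>c. P W c)"
  have W: "\<exists>c. P W c" and max: "\<And>W'. \<exists>c. P W' c \<Longrightarrow> card W' \<le> card W"
    using arg_max_natI[of "\<lambda>W. \<exists>c. P W c" _ card "Suc (CARD('v))"]
      arg_max_nat_le[of "\<lambda>W. \<exists>c. P W c" _ card "Suc (CARD('v))"] ex
    by (auto simp: W_def less_Suc_eq_le card_mono)
  obtain c where c: "P W c" using W by blast
  have "W = UNIV"
  proof (rule ccontr)
    assume nU: "W \<noteq> UNIV"
    have "X \<noteq> {}" using assms by auto
    then have Wne: "W \<noteq> {}" using c by (auto simp: P_def)
    \<comment> \<open>Otherwise \<open>W\<close> would have an empty boundary, against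
      \<open>k \<ge> 1\<close>.\<close>
    obtain u v where uv: "u \<in> W" "v \<notin> W" "{u, v} \<in> E"
      using closed_set_k_connected[OF assms(1) Wne, of "{}"] nU assms(4) by auto
    define c' where "c' = c(v := c u)"
    let ?R = "{(a, b). a \<in> W \<and> b \<in> W \<and> {a, b} \<in> E \<and> c a = c b}"
    let ?R' = "{(a, b). a \<in> insert v W \<and> b \<in> insert v W \<and> {a, b} \<in> E \<and> c' a = c' b}"
    have c'W: "c' a = c a" if "a \<in> W" for a using that uv by (auto simp: c'_def)
    have "?R \<subseteq> ?R'" using c'W by auto
    then have mono: "?R\<^sup>* \<subseteq> ?R'\<^sup>*" by (rule rtrancl_mono)
    have old: "(c' a, a) \<in> ?R'\<^sup>*" if "a \<in> W" for a
      using that c mono c'W[OF that] by (auto simp: P_def)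
    have "(u, v) \<in> ?R'" using uv c'W by (auto simp: c'_def)
    then have "(c' u, v) \<in> ?R'\<^sup>*" by (rule rtrancl_into_rtrancl[OF old[OF uv(1)]])
    moreover have "c' v = c' u" using uv by (auto simp: c'_def)
    ultimately have "(c' v, v) \<in> ?R'\<^sup>*" by simp
    with old have "\<forall>a\<in>insert v W. (c' a, a) \<in> ?R'\<^sup>*" by blast
    moreover have "c' ` insert v W \<subseteq> X" using c uv by (auto simp: c'_def P_def)
    moreover have "inj_on c' S"
      using c c'W inj_on_cong[of S c' c] by (auto simp: P_def)
    moreover have "\<forall>x\<in>X. c' x = x" using c c'W by (auto simp: P_def)
    ultimately have "P (insert v W) c'" using c by (auto simp: P_def)
    then have "card (insert v W) \<le> card W" using max by blast
    then show False using uv by simp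
  qed
  with c that[of c] show thesis by (auto simp: P_def)
qed

section \<open>Polynomial and rational functions\<close>

lemma finite_zeros_real_polynomial_function:
  fixes p :: "real \<Rightarrow> real"
  assumes "real_polynomial_function p" "p a \<noteq> 0"
  shows "finite {t. p t = 0}"
proof -
  obtain c n where p: "p = (\<lambda>x. \<Sum>i\<le>n. c i * x ^ i)"
    using real_polynomial_function_imp_sum[OF assms(1)] by blast
  have "\<exists>i\<le>n. c i \<noteq> 0"
  proof (rule ccontr)
    assume "\<not> (\<exists>i\<le>n. c i \<noteq> 0)"
    then have "p a = 0" by (simp add: p)
    with assms(2) show False by simp
  qed
  then show ?thesis
    unfolding p by (subst polyfun_finite_roots)
qed

lemma real_polynomial_function_compose':
  "polynomial_function f \<Longrightarrow> real_polynomial_function g \<Longrightarrow> real_polynomial_function (\<lambda>x. g (f x))"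
  using real_polynomial_function_compose[of f g] by (simp add: o_def)

text \<open>Along the parameterized line through \<open>a\<close> and \<open>b\<close> both
  polynomials become non-zero polynomials in one variable, so all but finitely many parameters
  serve.\<close>

lemma common_nonzero_on_subspace:
  fixes p q :: "'a::real_normed_vector \<Rightarrow> real"
  assumes "subspace W" "real_polynomial_function p" "real_polynomial_function q"
    and "a \<in> W" "p a \<noteq> 0" "b \<in> W" "q b \<noteq> 0"
  obtains c where "c \<in> W" "p c \<noteq> 0" "q c \<noteq> 0"
proof -
  define l where "l t = a + t *\<^sub>R (b - a)" for t :: real
  have "polynomial_function (\<lambda>t. t *\<^sub>R (b - a))"
    by (intro polynomial_function_bounded_linear bounded_linear_scaleR_left)
  then have l: "polynomial_function l"
    unfolding l_def by (intro polynomial_function_add polynomial_function_const)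
  have "finite {t. p (l t) = 0}"
    by (rule finite_zeros_real_polynomial_function[OF real_polynomial_function_compose'[OF l assms(2)], of 0])
      (simp add: l_def assms)
  moreover have "finite {t. q (l t) = 0}"
    by (rule finite_zeros_real_polynomial_function[OF real_polynomial_function_compose'[OF l assms(3)], of 1])
      (simp add: l_def assms)
  ultimately have "finite ({t. p (l t) = 0} \<union> {t. q (l t) = 0})" by simp
  then obtain t where "t \<notin> {t. p (l t) = 0} \<union> {t. q (l t) = 0}"
    using ex_new_if_finite[OF infinite_UNIV_char_0] by blast
  moreover have "l t \<in> W"
    unfolding l_def using assms by (intro subspace_add subspace_scale subspace_diff)
  ultimately show thesis using that[of "l t"] by simp
qed

lemma prod_nonzero_on_subspace:
  fixes p :: "'i \<Rightarrow> 'a::real_normed_vector \<Rightarrow> real"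
  assumes "subspace W" "finite I" "\<And>i. i \<in> I \<Longrightarrow> real_polynomial_function (p i)"
    and "\<And>i. i \<in> I \<Longrightarrow> \<exists>a\<in>W. p i a \<noteq> 0"
  shows "\<exists>a\<in>W. (\<Prod>i\<in>I. p i a) \<noteq> 0"
  using assms(2-)
proof (induction I rule: finite_induct)
  case empty
  then show ?case using subspace_0[OF assms(1)] by auto
next
  case (insert i I)
  obtain a where a: "a \<in> W" "(\<Prod>i\<in>I. p i a) \<noteq> 0" using insert by auto
  obtain b where b: "b \<in> W" "p i b \<noteq> 0" using insert.prems(2)[of i] by blast
  obtain c where "c \<in> W" "p i c \<noteq> 0" "(\<Prod>i\<in>I. p i c) \<noteq> 0"
  proof (rule common_nonzero_on_subspace[where p = "p i" and q = "\<lambda>x. \<Prod>i\<in>I. p i x", OF assms(1) _ _ b a])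
    show "real_polynomial_function (\<lambda>x. \<Prod>i\<in>I. p i x)"
      using insert by (intro real_polynomial_function_prod) auto
  qed (use insert in auto)
  with insert show ?case by auto
qed

section \<open>Arithmetic of rational functions\<close>

definition rational_function_on :: "'a::real_normed_vector set \<Rightarrow> ('a \<Rightarrow> real) \<Rightarrow> bool" where
  "rational_function_on U f \<longleftrightarrow> (\<exists>p q. real_polynomial_function p \<and> real_polynomial_function q \<and>
     (\<forall>x\<in>U. q x \<noteq> 0 \<and> f x = p x / q x))"

lemma rational_map_on_iff:
  "rational_map_on U f \<longleftrightarrow> (\<forall>b\<in>Basis. rational_function_on U (\<lambda>x. f x \<bullet> b))"
  by (simp add: rational_map_on_def rational_function_on_def)

lemma rational_function_onE:
  assumes "rational_function_on U f"
  obtains p q where "real_polynomial_function p" "real_polynomial_function q"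
    "\<And>x. x \<in> U \<Longrightarrow> q x \<noteq> 0" "\<And>x. x \<in> U \<Longrightarrow> f x = p x / q x"
  using assms unfolding rational_function_on_def by blast

lemma rational_function_onI:
  assumes "real_polynomial_function p" "real_polynomial_function q"
    "\<And>x. x \<in> U \<Longrightarrow> q x \<noteq> 0" "\<And>x. x \<in> U \<Longrightarrow> f x = p x / q x"
  shows "rational_function_on U f"
  using assms unfolding rational_function_on_def by blast

lemma rational_function_on_polynomial:
  "real_polynomial_function p \<Longrightarrow> rational_function_on U p"
  by (rule rational_function_onI[of p "\<lambda>_. 1"]) (auto intro: real_polynomial_function.intros(2))

lemma rational_function_on_const: "rational_function_on U (\<lambda>_. c)"
  by (intro rational_function_on_polynomial real_polynomial_function.intros(2))

lemma rational_function_on_add: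
  assumes "rational_function_on U f" "rational_function_on U g"
  shows "rational_function_on U (\<lambda>x. f x + g x)"
proof -
  obtain p q where pq: "real_polynomial_function p" "real_polynomial_function q"
    "\<And>x. x \<in> U \<Longrightarrow> q x \<noteq> 0" "\<And>x. x \<in> U \<Longrightarrow> f x = p x / q x"
    using rational_function_onE[OF assms(1)] by blast
  obtain r s where rs: "real_polynomial_function r" "real_polynomial_function s"
    "\<And>x. x \<in> U \<Longrightarrow> s x \<noteq> 0" "\<And>x. x \<in> U \<Longrightarrow> g x = r x / s x"
    using rational_function_onE[OF assms(2)] by blast
  show ?thesis
    by (rule rational_function_onI[of "\<lambda>x. p x * s x + r x * q x" "\<lambda>x. q x * s x"])
      (simp_all add: pq rs add_frac_eq real_polynomial_function.intros(3,4))
qed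

lemma rational_function_on_mult:
  assumes "rational_function_on U f" "rational_function_on U g"
  shows "rational_function_on U (\<lambda>x. f x * g x)"
proof -
  obtain p q where pq: "real_polynomial_function p" "real_polynomial_function q"
    "\<And>x. x \<in> U \<Longrightarrow> q x \<noteq> 0" "\<And>x. x \<in> U \<Longrightarrow> f x = p x / q x"
    using rational_function_onE[OF assms(1)] by blast
  obtain r s where rs: "real_polynomial_function r" "real_polynomial_function s"
    "\<And>x. x \<in> U \<Longrightarrow> s x \<noteq> 0" "\<And>x. x \<in> U \<Longrightarrow> g x = r x / s x"
    using rational_function_onE[OF assms(2)] by blast
  show ?thesis
    by (rule rational_function_onI[of "\<lambda>x. p x * r x" "\<lambda>x. q x * s x"])
      (simp_all add: pq rs real_polynomial_function.intros(4))
qed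

lemma rational_function_on_divide:
  assumes "rational_function_on U f" "rational_function_on U g" "\<And>x. x \<in> U \<Longrightarrow> g x \<noteq> 0"
  shows "rational_function_on U (\<lambda>x. f x / g x)"
proof -
  obtain p q where pq: "real_polynomial_function p" "real_polynomial_function q"
    "\<And>x. x \<in> U \<Longrightarrow> q x \<noteq> 0" "\<And>x. x \<in> U \<Longrightarrow> f x = p x / q x"
    using rational_function_onE[OF assms(1)] by blast
  obtain r s where rs: "real_polynomial_function r" "real_polynomial_function s"
    "\<And>x. x \<in> U \<Longrightarrow> s x \<noteq> 0" "\<And>x. x \<in> U \<Longrightarrow> g x = r x / s x"
    using rational_function_onE[OF assms(2)] by blast
  have "r x \<noteq> 0" if "x \<in> U" for x using assms(3)[OF that] rs(4)[OF that] by auto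
  then show ?thesis
    by (intro rational_function_onI[of "\<lambda>x. p x * s x" "\<lambda>x. q x * r x"])
      (simp_all add: pq rs real_polynomial_function.intros(4))
qed

lemma rational_function_on_sum:
  assumes "\<And>i. i \<in> I \<Longrightarrow> rational_function_on U (f i)"
  shows "rational_function_on U (\<lambda>x. \<Sum>i\<in>I. f i x)"
  using assms
  by (induction I rule: infinite_finite_induct)
    (auto intro: rational_function_on_add rational_function_on_const)

lemma rational_function_on_cong:
  "(\<And>x. x \<in> U \<Longrightarrow> f x = g x) \<Longrightarrow> rational_function_on U f \<longleftrightarrow> rational_function_on U g"
  unfolding rational_function_on_def by (metis (no_types))

lemma rational_function_on_polynomial_compose:
  fixes f :: "'a::euclidean_space \<Rightarrow> 'b::euclidean_space"
  assumes "real_polynomial_function p" "rational_map_on U f"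
  shows "rational_function_on U (\<lambda>x. p (f x))"
  using assms(1)
proof induction
  case (linear h)
  have "h (f x) = (\<Sum>b\<in>Basis. (f x \<bullet> b) * h b)" for x
    by (subst euclidean_representation[of "f x", symmetric])
      (simp add: linear_simps[OF linear] bounded_linear.linear[OF linear] linear_sum)
  moreover have "rational_function_on U (\<lambda>x. \<Sum>b\<in>Basis. (f x \<bullet> b) * h b)"
    using assms(2) by (intro rational_function_on_sum rational_function_on_mult rational_function_on_const)
      (simp add: rational_map_on_iff)
  ultimately show ?case by simp
qed (auto intro: rational_function_on_add rational_function_on_mult rational_function_on_const)

lemma rational_map_on_compose_polynomial:
  fixes f :: "'b::euclidean_space \<Rightarrow> 'c::euclidean_space" and h :: "'a::euclidean_space \<Rightarrow> 'b"
  assumes "rational_map_on U f" "polynomial_function h" "h ` V \<subseteq> U"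
  shows "rational_map_on V (\<lambda>x. f (h x))"
  unfolding rational_map_on_iff
proof
  fix b :: 'c assume b: "b \<in> Basis"
  obtain p q where pq: "real_polynomial_function p" "real_polynomial_function q"
    "\<And>x. x \<in> U \<Longrightarrow> q x \<noteq> 0" "\<And>x. x \<in> U \<Longrightarrow> f x \<bullet> b = p x / q x"
    using rational_function_onE assms(1)[unfolded rational_map_on_iff, rule_format, OF b] by blast
  have "h x \<in> U" if "x \<in> V" for x using assms(3) that by blast
  then show "rational_function_on V (\<lambda>x. f (h x) \<bullet> b)"
    using pq by (intro rational_function_onI[of "\<lambda>x. p (h x)" "\<lambda>x. q (h x)"]
        real_polynomial_function_compose'[OF assms(2)]) simp_all
qed

lemma rational_map_on_add:
  "rational_map_on U f \<Longrightarrow> rational_map_on U g \<Longrightarrow> rational_map_on U (\<lambda>x. f x + g x)"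
  by (simp add: rational_map_on_iff inner_add_left rational_function_on_add)

lemma rational_map_on_diff:
  assumes "rational_map_on U f" "rational_map_on U g"
  shows "rational_map_on U (\<lambda>x. f x - g x)"
  unfolding rational_map_on_iff
proof
  fix b :: 'b assume "b \<in> Basis"
  then have "rational_function_on U (\<lambda>x. f x \<bullet> b + (-1) * (g x \<bullet> b))"
    using assms by (intro rational_function_on_add rational_function_on_mult rational_function_on_const)
      (simp_all add: rational_map_on_iff)
  then show "rational_function_on U (\<lambda>x. (f x - g x) \<bullet> b)"
    by (simp add: inner_diff_left)
qed

lemma rational_map_on_polynomial:
  "polynomial_function f \<Longrightarrow> rational_map_on U f"
  by (simp add: polynomial_function_iff_Basis_inner rational_map_on_iff rational_function_on_polynomial)

section \<open>Derivatives and smoothness of rational maps\<close>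

lemma real_polynomial_function_has_derivative:
  assumes "real_polynomial_function p"
  shows "\<exists>p'. (\<forall>v. real_polynomial_function (\<lambda>x. p' x v)) \<and> (\<forall>x. (p has_derivative p' x) (at x))"
  using assms
proof induction
  case (linear f)
  then show ?case
    by (intro exI[of _ "\<lambda>_. f"]) (auto intro: bounded_linear_imp_has_derivative)
next
  case (const c)
  then show ?case by (intro exI[of _ "\<lambda>_ _. 0"]) auto
next
  case (add f g)
  then obtain f' g' where "\<forall>v. real_polynomial_function (\<lambda>x. f' x v)"
    "\<forall>v. real_polynomial_function (\<lambda>x. g' x v)"
    "\<forall>x. (f has_derivative f' x) (at x)" "\<forall>x. (g has_derivative g' x) (at x)" by blast
  then show ?case
    by (intro exI[of _ "\<lambda>x v. f' x v + g' x v"])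
      (auto intro!: has_derivative_add real_polynomial_function.intros(3))
next
  case (mult f g)
  then obtain f' g' where "\<forall>v. real_polynomial_function (\<lambda>x. f' x v)"
    "\<forall>v. real_polynomial_function (\<lambda>x. g' x v)"
    "\<forall>x. (f has_derivative f' x) (at x)" "\<forall>x. (g has_derivative g' x) (at x)" by blast
  with mult show ?case
    by (intro exI[of _ "\<lambda>x v. f x * g' x v + f' x v * g x"])
      (auto intro!: has_derivative_mult real_polynomial_function.intros(3) real_polynomial_function.intros(4))
qed

lemma rational_function_on_has_derivative:
  fixes f :: "'a::real_normed_vector \<Rightarrow> real"
  assumes "open S" "rational_function_on S f"
  obtains f' where "\<And>x. x \<in> S \<Longrightarrow> (f has_derivative f' x) (at x)"
    "\<And>v. rational_function_on S (\<lambda>x. f' x v)"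
proof -
  obtain p q where pq: "real_polynomial_function p" "real_polynomial_function q"
    "\<And>x. x \<in> S \<Longrightarrow> q x \<noteq> 0" "\<And>x. x \<in> S \<Longrightarrow> f x = p x / q x"
    using rational_function_onE[OF assms(2)] by blast
  obtain p' where p': "\<And>v. real_polynomial_function (\<lambda>x. p' x v)" "\<And>x. (p has_derivative p' x) (at x)"
    using real_polynomial_function_has_derivative[OF pq(1)] by blast
  obtain q' where q': "\<And>v. real_polynomial_function (\<lambda>x. q' x v)" "\<And>x. (q has_derivative q' x) (at x)"
    using real_polynomial_function_has_derivative[OF pq(2)] by blast
  let ?f' = "\<lambda>x v. (p' x v * q x - p x * q' x v) / (q x * q x)"
  have "(f has_derivative ?f' x) (at x)" if "x \<in> S" for x
  \<comment> \<open>\<open>f\<close> is given by the quotient only on \<open>S\<close>; openness of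
    \<open>S\<close> carries the derivative over.\<close>
  proof (rule has_derivative_transform_within_open[OF _ assms(1) that])
    show "((\<lambda>x. p x / q x) has_derivative ?f' x) (at x)"
      by (rule has_derivative_divide'[OF p'(2) q'(2) pq(3)[OF that]])
  qed (simp add: pq(4))
  moreover have "rational_function_on S (\<lambda>x. ?f' x v)" for v
    using pq p' q' by (intro rational_function_on_divide rational_function_on_polynomial
        real_polynomial_function_diff real_polynomial_function.intros(4)) auto
  ultimately show thesis using that[of ?f'] by blast
qed

lemma rational_map_on_has_derivative:
  fixes f :: "'a::euclidean_space \<Rightarrow> 'b::euclidean_space"
  assumes "open S" "rational_map_on S f"
  shows "(\<forall>x\<in>S. f differentiable (at x)) \<and>
    rational_map_on S (\<lambda>x. frechet_derivative f (at x) v)"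
proof -
  have "\<exists>f'. (\<forall>x\<in>S. ((\<lambda>x. f x \<bullet> b) has_derivative f' x) (at x)) \<and>
      (\<forall>v. rational_function_on S (\<lambda>x. f' x v))" if "b \<in> Basis" for b
    using rational_function_on_has_derivative[OF assms(1), of "\<lambda>x. f x \<bullet> b"] assms(2) that
    unfolding rational_map_on_iff by metis
  then obtain f' where f': "\<And>b x. b \<in> Basis \<Longrightarrow> x \<in> S \<Longrightarrow> ((\<lambda>x. f x \<bullet> b) has_derivative f' b x) (at x)"
    "\<And>b v. b \<in> Basis \<Longrightarrow> rational_function_on S (\<lambda>x. f' b x v)" by metis
  let ?D = "\<lambda>x v. \<Sum>b\<in>Basis. f' b x v *\<^sub>R b"
  have D: "(f has_derivative ?D x) (at x)" if "x \<in> S" for x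
    by (subst has_derivative_componentwise_within) (use f'(1) that in auto)
  then have "frechet_derivative f (at x) v \<bullet> b = f' b x v" if "x \<in> S" "b \<in> Basis" for x b
    using that(2) by (simp add: frechet_derivative_at[OF D[OF that(1)], symmetric])
  then have "rational_map_on S (\<lambda>x. frechet_derivative f (at x) v)"
    unfolding rational_map_on_iff using f'(2) by (simp cong: rational_function_on_cong)
  moreover have "f differentiable (at x)" if "x \<in> S" for x
    using D[OF that] by (rule differentiableI)
  ultimately show ?thesis by blast
qed

text \<open>By the quotient rule each directional derivative of a rational map is again rational on
  the same set, so induction on the order of differentiation applies to the whole class.\<close>

lemma rational_map_on_smooth:
  fixes f :: "'a::euclidean_space \<Rightarrow> 'b::euclidean_space"
  assumes "open S" "rational_map_on S f"
  shows "smooth_map_on S f"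
proof -
  have "times_differentiable_on k S f" for k
    using assms(2)
  proof (induction k arbitrary: f)
    case 0
    have "continuous (at x) f" if "x \<in> S" for x
      using rational_map_on_has_derivative[OF assms(1) 0] that
      by (intro differentiable_imp_continuous_within) blast
    then show ?case by (simp add: continuous_at_imp_continuous_on)
  next
    case (Suc k)
    have "times_differentiable_on k S (\<lambda>x. frechet_derivative f (at x) v)" for v
      using rational_map_on_has_derivative[OF assms(1) Suc.prems] by (intro Suc.IH) blast
    with rational_map_on_has_derivative[OF assms(1) Suc.prems] show ?case by simp
  qed
  with assms(1) show ?thesis by (simp add: smooth_map_on_def)
qed

section \<open>Matrices with polynomial or rational entries\<close>

lemma real_polynomial_function_vec_nth: "real_polynomial_function (\<lambda>w::real^'n. w $ i)"
  by (intro real_polynomial_function.intros(1) bounded_linear_vec_nth)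

lemma real_polynomial_function_det:
  fixes A :: "'a::real_normed_vector \<Rightarrow> real^'n^'n"
  assumes "\<And>i j. real_polynomial_function (\<lambda>x. A x $ i $ j)"
  shows "real_polynomial_function (\<lambda>x. det (A x))"
  unfolding det_def using assms
  by (intro real_polynomial_function_sum real_polynomial_function.intros(4) real_polynomial_function.intros(2)
      real_polynomial_function_prod) auto

lemma rational_map_on_matrix_iff:
  fixes A :: "'a::euclidean_space \<Rightarrow> real^'n^'m"
  shows "rational_map_on U A \<longleftrightarrow> (\<forall>i j. rational_function_on U (\<lambda>x. A x $ i $ j))"
  by (auto simp: rational_map_on_iff Basis_vec_def inner_axis)

lemma rational_map_on_matrix_mult:
  fixes A :: "'a::euclidean_space \<Rightarrow> real^'n^'m" and B :: "'a \<Rightarrow> real^'k^'n"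
  assumes "rational_map_on U A" "rational_map_on U B"
  shows "rational_map_on U (\<lambda>x. A x ** B x)"
  using assms unfolding rational_map_on_matrix_iff matrix_matrix_mult_def
  by (auto intro!: rational_function_on_sum rational_function_on_mult)

lemma matrix_inv_inverse:
  fixes A :: "real^'n^'n"
  assumes "det A \<noteq> 0"
  shows "A ** matrix_inv A = mat 1" "matrix_inv A ** A = mat 1"
proof -
  have "\<exists>B. A ** B = mat 1 \<and> B ** A = mat 1"
    using assms by (simp add: invertible_det_nz[symmetric] invertible_def)
  from someI_ex[OF this] show "A ** matrix_inv A = mat 1" "matrix_inv A ** A = mat 1"
    by (simp_all add: matrix_inv_def)
qed

text \<open>Cramer's rule, with the \<open>l\<close>-th column of the identity as right-hand side.
  It shows that inversion keeps entries rational.\<close>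

lemma matrix_inv_nth:
  fixes A :: "real^'n^'n"
  assumes "det A \<noteq> 0"
  shows "matrix_inv A $ k $ l = det (\<chi> i j. if j = k then mat 1 $ i $ l else A $ i $ j) / det A"
proof -
  have inv: "A ** matrix_inv A = mat 1"
    using assms by (rule matrix_inv_inverse)
  have "A *v column l (matrix_inv A) = column l (mat 1)"
    by (metis inv matrix_vector_mul_assoc matrix_vector_mult_basis matrix_vector_mul_lid)
  from this[unfolded cramer[OF assms]] show ?thesis
    by (simp add: column_def vec_eq_iff cong: if_cong)
qed

lemma rational_map_on_matrix_inv:
  fixes A :: "'a::euclidean_space \<Rightarrow> real^'n^'n"
  assumes "\<And>i j. real_polynomial_function (\<lambda>x. A x $ i $ j)" "\<And>x. x \<in> U \<Longrightarrow> det (A x) \<noteq> 0"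
  shows "rational_map_on U (\<lambda>x. matrix_inv (A x))"
proof -
  have "real_polynomial_function (\<lambda>x. if j = k then mat 1 $ i $ l else A x $ i $ j)" for i j k l
    using assms(1) by (cases "j = k") auto
  then have "rational_function_on U
      (\<lambda>x. det (\<chi> i j. if j = k then mat 1 $ i $ l else A x $ i $ j) / det (A x))" for k l
    using assms by (intro rational_function_on_divide rational_function_on_polynomial
        real_polynomial_function_det) auto
  then show ?thesis
    unfolding rational_map_on_matrix_iff using assms(2)
    by (simp add: matrix_inv_nth cong: rational_function_on_cong)
qed

section \<open>Weighted Laplacians\<close>

text \<open>The guard \<open>i \<noteq> j\<close> is there since \<open>{i, i}\<close> is the
  singleton \<open>{i}\<close>, which also indexes a coordinate of \<open>w\<close>.\<close>

definition conductance :: "'v set set \<Rightarrow> real^('v::finite set) \<Rightarrow> 'v \<Rightarrow> 'v \<Rightarrow> real" where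
  "conductance F w i j = (if i \<noteq> j \<and> {i, j} \<in> F then w $ {i, j} else 0)"

definition laplacian :: "'v set set \<Rightarrow> real^('v::finite set) \<Rightarrow> real^'v^'v" where
  "laplacian F w = (\<chi> i j. if i = j then \<Sum>k\<in>UNIV. conductance F w i k else - conductance F w i j)"

lemma conductance_sym: "conductance F w i j = conductance F w j i"
  by (simp add: conductance_def insert_commute)

lemma conductance_refl [simp]: "conductance F w i i = 0"
  by (simp add: conductance_def)

lemma transpose_laplacian: "transpose (laplacian F w) = laplacian F w"
  by (auto simp: transpose_def laplacian_def vec_eq_iff conductance_sym)

lemma laplacian_mult_nth:
  "(laplacian F w *v z) $ i = (\<Sum>j\<in>UNIV. conductance F w i j * (z $ i - z $ j))"
proof -
  have "(laplacian F w *v z) $ i = (\<Sum>j\<in>UNIV. (if j = i then (\<Sum>k\<in>UNIV. conductance F w i k) * z $ i else 0)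
      - conductance F w i j * z $ j)"
    by (auto simp: matrix_vector_mult_def laplacian_def intro!: sum.cong)
  also have "\<dots> = (\<Sum>k\<in>UNIV. conductance F w i k) * z $ i - (\<Sum>j\<in>UNIV. conductance F w i j * z $ j)"
    by (simp add: sum_subtractf)
  also have "\<dots> = (\<Sum>j\<in>UNIV. conductance F w i j * (z $ i - z $ j))"
    by (simp add: sum_distrib_right right_diff_distrib sum_subtractf)
  finally show ?thesis .
qed

lemma laplacian_mult_one: "laplacian F w *v 1 = 0"
  by (simp add: vec_eq_iff laplacian_mult_nth)

lemma real_polynomial_function_laplacian:
  "real_polynomial_function (\<lambda>w. laplacian F w $ i $ j)"
proof -
  have "real_polynomial_function (\<lambda>w. conductance F w i j)" for i j
    by (cases "i \<noteq> j \<and> {i, j} \<in> F")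
      (auto simp: conductance_def intro: real_polynomial_function_vec_nth real_polynomial_function.intros(2))
  then show ?thesis
    by (cases "i = j")
      (auto simp: laplacian_def intro!: real_polynomial_function_sum real_polynomial_function_minus)
qed

lemma sum_antisymmetric_eq_0:
  fixes g :: "'a \<Rightarrow> 'a \<Rightarrow> real"
  assumes "\<And>i j. g i j = - g j i"
  shows "(\<Sum>i\<in>A. \<Sum>j\<in>A. g i j) = 0"
proof -
  have "(\<Sum>i\<in>A. \<Sum>j\<in>A. g i j) = (\<Sum>i\<in>A. \<Sum>j\<in>A. g j i)" by (rule sum.swap)
  also have "\<dots> = - (\<Sum>i\<in>A. \<Sum>j\<in>A. g i j)"
    by (subst assms) (simp add: sum_negf)
  finally show ?thesis by simp
qed

text \<open>The Dirichlet form, the weighted sum of squared differences of \<open>z\<close>, is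
  twice the inner product of \<open>z\<close> with its Laplacian image. So it vanishes, and with
  non-negative conductances each of its terms does.\<close>

lemma laplacian_kernel_constant:
  assumes "\<And>i j. conductance F w i j \<ge> 0" "laplacian F w *v z = 0" "conductance F w i j \<noteq> 0"
  shows "z $ i = z $ j"
proof -
  let ?a = "conductance F w"
  have "0 = (\<Sum>i\<in>UNIV. z $ i * (\<Sum>j\<in>UNIV. ?a i j * (z $ i - z $ j)))"
    using assms(2) by (simp add: laplacian_mult_nth[symmetric])
  also have "\<dots> = (\<Sum>i\<in>UNIV. \<Sum>j\<in>UNIV. z $ i * (?a i j * (z $ i - z $ j)))"
    by (simp add: sum_distrib_left)
  finally have 1: "(\<Sum>i\<in>UNIV. \<Sum>j\<in>UNIV. z $ i * (?a i j * (z $ i - z $ j))) = 0" by simp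
  then have 2: "(\<Sum>i\<in>UNIV. \<Sum>j\<in>UNIV. z $ j * (?a j i * (z $ j - z $ i))) = 0"
    by (subst sum.swap)
  \<comment> \<open>Adding the double sum to its transpose turns the products into squares.\<close>
  have "(\<Sum>i\<in>UNIV. \<Sum>j\<in>UNIV. ?a i j * (z $ i - z $ j)\<^sup>2) =
      (\<Sum>i\<in>UNIV. \<Sum>j\<in>UNIV. z $ i * (?a i j * (z $ i - z $ j)) + z $ j * (?a j i * (z $ j - z $ i)))"
    by (intro sum.cong refl) (simp add: conductance_sym[of F w] algebra_simps power2_eq_square)
  also have "\<dots> = 0" using 1 2 by (simp add: sum.distrib)
  finally have "\<forall>i. (\<Sum>j\<in>UNIV. ?a i j * (z $ i - z $ j)\<^sup>2) = 0"
    using assms(1) by (subst (asm) sum_nonneg_eq_0_iff) (auto intro!: sum_nonneg)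
  then have "(\<Sum>j\<in>UNIV. ?a i j * (z $ i - z $ j)\<^sup>2) = 0" by blast
  then have "?a i j * (z $ i - z $ j)\<^sup>2 = 0"
    using assms(1) by (subst (asm) sum_nonneg_eq_0_iff) auto
  with assms(3) show ?thesis by simp
qed

text \<open>When \<open>X\<close> and \<open>S\<close> have equal size, this is the invertibility of
  the submatrix of the Laplacian with the rows outside \<open>S\<close> and the columns outside
  \<open>X\<close>. The kernel form needs no reindexing.\<close>

definition nondegenerate :: "'v::finite set set \<Rightarrow> 'v set \<Rightarrow> real^('v set) \<Rightarrow> 'v set \<Rightarrow> bool" where
  "nondegenerate F S w X \<longleftrightarrow>
     (\<forall>z. (\<forall>x\<in>X. z $ x = 0) \<longrightarrow> (\<forall>t. t \<notin> S \<longrightarrow> (laplacian F w *v z) $ t = 0) \<longrightarrow> z = 0)"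

text \<open>
  Give weight 1 to the edges inside the parts of a partition into connected pieces, each
  meeting S and X in one vertex. The values of the Laplacian sum to 0 over each piece, so a
  vector that is harmonic off S is harmonic everywhere, hence constant on the pieces.
\<close>

lemma ex_nondegenerate:
  fixes E :: "'v::finite set set"
  assumes "simple_graph E" "k_connected k E" "card S = k" "card X = k" "k \<ge> 1"
  shows "\<exists>w\<in>weight_space (E - nsets S 2). nondegenerate (E - nsets S 2) S w X"
proof -
  obtain c where c: "\<And>x. x \<in> X \<Longrightarrow> c x = x" "range c \<subseteq> X" "inj_on c S"
    "\<And>v. (c v, v) \<in> {(a, b). {a, b} \<in> E \<and> c a = c b}\<^sup>*"
    using k_connected_partition[OF assms(2-5)] by blast
  define F where "F = E - nsets S 2"
  define w :: "real^('v set)" where "w = (\<chi> e. if e \<in> F \<and> (\<exists>x. c ` e = {x}) then 1 else 0)"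
  have edge: "i \<noteq> j" if "{i, j} \<in> E" for i j
    using that assms(1) unfolding simple_graph_def by (metis doubleton_in_nsets_2 subsetD)
  have cond: "conductance F w i j = (if {i, j} \<in> E \<and> c i = c j then 1 else 0)" for i j
  proof -
    \<comment> \<open>An edge within a piece is never a clique edge, because a piece contains at
      most one vertex of \<open>S\<close>.\<close>
    have "{i, j} \<in> F" if "{i, j} \<in> E" "c i = c j"
      using that c(3) edge[of i j] by (auto simp: F_def inj_on_def)
    then show ?thesis using edge[of i j] by (auto simp: conductance_def w_def F_def)
  qed
  have cS: "c ` S = X"
    using c(2,3) assms(3,4) by (intro card_subset_eq) (auto simp: card_image)
  have "nondegenerate F S w X"
    unfolding nondegenerate_def
  proof (intro allI impI)
    fix z assume zX: "\<forall>x\<in>X. z $ x = 0" and zS: "\<forall>t. t \<notin> S \<longrightarrow> (laplacian F w *v z) $ t = 0"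
    have "(laplacian F w *v z) $ s = 0" if s: "s \<in> S" for s
    proof -
      let ?C = "{v. c v = c s}"
      have "(\<Sum>i\<in>?C. (laplacian F w *v z) $ i) = (\<Sum>i\<in>?C. \<Sum>j\<in>?C. conductance F w i j * (z $ i - z $ j))"
        unfolding laplacian_mult_nth by (intro sum.cong refl sum.mono_neutral_right) (auto simp: cond)
      also have "\<dots> = 0"
        by (rule sum_antisymmetric_eq_0) (simp add: conductance_sym[of F w] algebra_simps)
      finally have "0 = (\<Sum>i\<in>?C. (laplacian F w *v z) $ i)" by simp
      \<comment> \<open>\<open>s\<close> is the only vertex of \<open>S\<close> in its piece, and
        \<open>z\<close> is harmonic off \<open>S\<close>.\<close>
      also have "\<dots> = (\<Sum>i\<in>{s}. (laplacian F w *v z) $ i)"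
        using s c(3) zS by (intro sum.mono_neutral_right) (auto simp: inj_on_def)
      finally show ?thesis by simp
    qed
    then have "laplacian F w *v z = 0" using zS by (auto simp: vec_eq_iff)
    moreover have "conductance F w i j \<ge> 0" for i j by (simp add: cond)
    ultimately have const: "z $ a = z $ b" if "{a, b} \<in> E" "c a = c b" for a b
      using laplacian_kernel_constant[of F w z a b] that by (simp add: cond)
    have "z $ v = 0" for v
    proof -
      have "z $ v = z $ a" if "(a, v) \<in> {(a, b). {a, b} \<in> E \<and> c a = c b}\<^sup>*" for a
        using that by induction (auto dest: const)
      from this[OF c(4)] show ?thesis using zX c(2) by auto
    qed
    then show "z = 0" by (simp add: vec_eq_iff)
  qed
  moreover have "w \<in> weight_space F" by (simp add: weight_space_def w_def)
  ultimately show ?thesis unfolding F_def by blast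
qed

section \<open>Minors and blocks as matrices over all vertices\<close>

lemma det_nonzero_iff_kernel:
  fixes A :: "real^'n^'n"
  shows "det A \<noteq> 0 \<longleftrightarrow> (\<forall>z. A *v z = 0 \<longrightarrow> z = 0)"
  by (metis invertible_det_nz invertible_left_inverse matrix_left_invertible_ker)

text \<open>Multiplication by it stands for passing to a block of rows or columns while keeping the
  index type.\<close>

definition coord_proj :: "'v::finite set \<Rightarrow> real^'v^'v" where
  "coord_proj T = (\<chi> i j. if i = j \<and> i \<in> T then 1 else 0)"

lemma coord_proj_mult_nth: "(coord_proj T *v z) $ i = (if i \<in> T then z $ i else 0)"
proof -
  have "(coord_proj T *v z) $ i = (\<Sum>j\<in>UNIV. if j = i then (if i \<in> T then z $ i else 0) else 0)"
    unfolding matrix_vector_mult_def coord_proj_def vec_lambda_beta by (intro sum.cong refl) auto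
  then show ?thesis by simp
qed

lemma coord_proj_idem: "coord_proj T ** coord_proj T = coord_proj T"
  by (simp add: matrix_eq matrix_vector_mul_assoc[symmetric] vec_eq_iff coord_proj_mult_nth)

lemma transpose_coord_proj: "transpose (coord_proj T) = coord_proj T"
  by (auto simp: transpose_def coord_proj_def vec_eq_iff)

lemma dim_vanishing_on:
  "dim {z :: real^'v::finite. \<forall>s\<in>S. z $ s = 0} = CARD('v) - card S"
proof -
  have "dim {z :: real^'v. \<forall>i. i \<notin> - S \<longrightarrow> z $ i = 0} = card (- S)"
    using dim_substandard_cart[of "- S", where 'a = real] by (simp add: dim_vec_eq)
  then show ?thesis by (simp add: Compl_eq_Diff_UNIV card_Diff_subset Ball_def)
qed

lemma subspace_vanishing_on: "subspace {z :: real^'v::finite. \<forall>s\<in>S. z $ s = 0}"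
  by (auto simp: subspace_def)

text \<open>In the Laplacian the rows of \<open>S\<close> are replaced by the equations
  \<open>z $ x = 0\<close>, one for each \<open>x\<close> in \<open>X\<close>. The determinant of
  the resulting square matrix is, up to sign, the minor with rows off \<open>S\<close> and columns
  off \<open>X\<close>.\<close>

lemma ex_nondegenerate_polynomial:
  fixes S X :: "'v::finite set"
  assumes "card X = card S"
  shows "\<exists>p. real_polynomial_function p \<and> (\<forall>w. nondegenerate F S w X \<longleftrightarrow> p w \<noteq> 0)"
proof -
  obtain \<beta> where \<beta>: "bij_betw \<beta> X S"
    using assms finite_same_card_bij[of X S] by auto
  define R :: "real^'v^'v" where "R = (\<chi> i j. if j \<in> X \<and> \<beta> j = i then 1 else 0)"
  have RS: "(R *v z) $ (\<beta> x) = z $ x" if "x \<in> X" for z x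
  proof -
    have "(R *v z) $ (\<beta> x) = (\<Sum>j\<in>UNIV. if j = x then z $ x else 0)"
      unfolding matrix_vector_mult_def R_def vec_lambda_beta
      using \<beta> that by (intro sum.cong refl) (auto simp: bij_betw_def inj_on_def)
    then show ?thesis by simp
  qed
  have RT: "(R *v z) $ t = 0" if "t \<notin> S" for z t
    using \<beta> that by (auto simp: matrix_vector_mult_def R_def bij_betw_def intro!: sum.neutral)
  define A where "A w = (\<chi> i. if i \<in> S then R $ i else laplacian F w $ i)" for w
  have A: "(A w *v z) $ i = (if i \<in> S then (R *v z) $ i else (laplacian F w *v z) $ i)" for w z i
    by (simp add: A_def matrix_vector_mult_def)
  have "A w *v z = 0 \<longleftrightarrow> (\<forall>x\<in>X. z $ x = 0) \<and> (\<forall>t. t \<notin> S \<longrightarrow> (laplacian F w *v z) $ t = 0)" for w z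
  proof -
    have "(\<forall>i\<in>S. (R *v z) $ i = 0) \<longleftrightarrow> (\<forall>x\<in>X. z $ x = 0)"
      using \<beta> RS by (auto simp: bij_betw_def)
    then show ?thesis by (auto simp: vec_eq_iff A)
  qed
  then have "nondegenerate F S w X \<longleftrightarrow> det (A w) \<noteq> 0" for w
    by (auto simp: det_nonzero_iff_kernel nondegenerate_def)
  moreover have "real_polynomial_function (\<lambda>w. A w $ i $ j)" for i j
    by (cases "i \<in> S") (simp_all add: A_def real_polynomial_function_laplacian real_polynomial_function.intros(2))
  ultimately show ?thesis by (intro exI[of _ "\<lambda>w. det (A w)"] conjI real_polynomial_function_det) auto
qed

text \<open>
  The block of the Laplacian with rows and columns outside S, completed by an identity block
  so that it can be inverted as a square matrix indexed by all vertices.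
\<close>

definition free_block :: "'v set set \<Rightarrow> 'v set \<Rightarrow> real^('v::finite set) \<Rightarrow> real^'v^'v" where
  "free_block F S w = coord_proj (- S) ** laplacian F w ** coord_proj (- S) + coord_proj S"

lemma free_block_mult_nth:
  "(free_block F S w *v z) $ i = (if i \<in> S then z $ i else (laplacian F w *v (coord_proj (- S) *v z)) $ i)"
  by (simp add: free_block_def matrix_vector_mult_add_rdistrib matrix_vector_mul_assoc[symmetric]
      coord_proj_mult_nth)

lemma det_free_block:
  "det (free_block F S w) \<noteq> 0 \<longleftrightarrow> nondegenerate F S w S"
proof -
  have "free_block F S w *v z = 0 \<longleftrightarrow>
      (\<forall>s\<in>S. z $ s = 0) \<and> (\<forall>t. t \<notin> S \<longrightarrow> (laplacian F w *v z) $ t = 0)" for z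
  proof -
    have 0: "free_block F S w *v z = 0 \<longleftrightarrow> (\<forall>s\<in>S. z $ s = 0) \<and>
        (\<forall>t. t \<notin> S \<longrightarrow> (laplacian F w *v (coord_proj (- S) *v z)) $ t = 0)"
      by (auto simp: vec_eq_iff[of "_ *v z"] free_block_mult_nth)
    \<comment> \<open>The identity block makes kernel vectors vanish on \<open>S\<close>, so
      projecting them changes nothing.\<close>
    have "coord_proj (- S) *v z = z" if "\<forall>s\<in>S. z $ s = 0"
      using that by (simp add: vec_eq_iff coord_proj_mult_nth)
    then show ?thesis unfolding 0 by auto
  qed
  then show ?thesis by (auto simp: det_nonzero_iff_kernel nondegenerate_def)
qed

text \<open>
  A symmetric matrix whose rank is the size of an invertible principal block C is
  (L P) C^{-1} (P L), where P L consists of the rows through that block.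
\<close>

definition stress :: "'v set set \<Rightarrow> 'v set \<Rightarrow> real^('v::finite set) \<Rightarrow> real^'v^'v" where
  "stress F S w = laplacian F w ** coord_proj (- S) ** matrix_inv (free_block F S w) **
     (coord_proj (- S) ** laplacian F w)"

lemma transpose_matrix_add: "transpose (A + B) = transpose A + transpose (B :: real^'n^'m)"
  by (simp add: transpose_def vec_eq_iff)

lemma transpose_free_block: "transpose (free_block F S w) = free_block F S w"
  by (simp add: free_block_def transpose_matrix_add matrix_transpose_mul transpose_coord_proj
      transpose_laplacian matrix_mul_assoc)

lemma transpose_matrix_inv:
  fixes A :: "real^'n^'n"
  assumes "det A \<noteq> 0" "transpose A = A"
  shows "transpose (matrix_inv A) = matrix_inv A"
proof -
  have "transpose (matrix_inv A) ** A = mat 1"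
    using matrix_inv_inverse(1)[OF assms(1)] by (metis assms(2) matrix_transpose_mul transpose_mat)
  then have "transpose (matrix_inv A) ** (A ** matrix_inv A) = matrix_inv A"
    by (simp add: matrix_mul_assoc)
  then show ?thesis by (simp add: matrix_inv_inverse(1)[OF assms(1)])
qed

lemma transpose_stress:
  assumes "det (free_block F S w) \<noteq> 0"
  shows "transpose (stress F S w) = stress F S w"
  by (simp add: stress_def matrix_transpose_mul transpose_coord_proj transpose_laplacian
      transpose_matrix_inv[OF assms transpose_free_block] matrix_mul_assoc)

text \<open>Let \<open>P\<close> be the projection off \<open>S\<close>, \<open>L\<close> the
  Laplacian and \<open>C\<close> the completed block. \<open>P\<close> kills the identity block of
  \<open>C\<close>, so \<open>P L P = P C\<close> and the inverse of \<open>C\<close> cancels; thus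
  the stress inherits the free rows of \<open>L\<close>.\<close>

lemma coord_proj_stress:
  assumes "det (free_block F S w) \<noteq> 0"
  shows "coord_proj (- S) ** stress F S w = coord_proj (- S) ** laplacian F w"
proof -
  let ?P = "coord_proj (- S)" and ?L = "laplacian F w" and ?C = "free_block F S w"
  let ?D = "matrix_inv ?C"
  note D = matrix_inv_inverse[OF assms]
  have PC: "?P ** ?C = ?P ** ?L ** ?P"
    by (simp add: matrix_eq matrix_vector_mul_assoc[symmetric] vec_eq_iff coord_proj_mult_nth
        free_block_mult_nth)
  have CP: "?C ** ?P = ?P ** ?L ** ?P"
    by (simp add: matrix_eq matrix_vector_mul_assoc[symmetric] vec_eq_iff coord_proj_mult_nth
        free_block_mult_nth) (simp add: matrix_vector_mul_assoc coord_proj_idem)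
  have "?P ** stress F S w = (?P ** ?L ** ?P) ** ?D ** (?P ** ?L)"
    by (simp add: stress_def matrix_mul_assoc)
  also have "\<dots> = ?P ** (?C ** ?D) ** (?P ** ?L)"
    by (simp add: PC[symmetric] matrix_mul_assoc)
  also have "\<dots> = ?P ** ?P ** ?L"
    by (simp add: D matrix_mul_assoc)
  finally show ?thesis by (simp add: coord_proj_idem)
qed

lemma stress_nth:
  fixes S :: "'v::finite set"
  assumes "det (free_block F S w) \<noteq> 0" "t \<notin> S"
  shows "stress F S w $ t $ j = laplacian F w $ t $ j"
proof -
  have *: "(coord_proj (- S) ** A) $ t $ j = A $ t $ j" for A :: "real^'v^'v"
  proof -
    have "(coord_proj (- S) ** A) $ t $ j = (coord_proj (- S) *v column j A) $ t"
      by (simp add: matrix_matrix_mult_def matrix_vector_mult_def column_def)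
    then show ?thesis using assms(2) by (simp add: coord_proj_mult_nth column_def)
  qed
  show ?thesis using arg_cong[OF coord_proj_stress[OF assms(1)], of "\<lambda>A. A $ t $ j"] by (simp add: *)
qed

lemma rational_map_on_stress:
  assumes "\<And>w. w \<in> U \<Longrightarrow> det (free_block F S w) \<noteq> 0"
  shows "rational_map_on U (stress F S)"
proof -
  have L: "rational_map_on U (laplacian F)"
    by (simp add: rational_map_on_matrix_iff rational_function_on_polynomial real_polynomial_function_laplacian)
  have P: "rational_map_on U (\<lambda>_. coord_proj (- S))"
    by (simp add: rational_map_on_matrix_iff rational_function_on_const)
  have "real_polynomial_function (\<lambda>w. free_block F S w $ i $ j)" for i j
    unfolding free_block_def matrix_matrix_mult_def
    by (auto intro!: real_polynomial_function.intros(3,4) real_polynomial_function_sum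
        real_polynomial_function_laplacian)
  then have D: "rational_map_on U (\<lambda>w. matrix_inv (free_block F S w))"
    using assms by (intro rational_map_on_matrix_inv) auto
  show ?thesis
    unfolding stress_def[abs_def]
    by (intro rational_map_on_matrix_mult L P D)
qed

section \<open>General position stress matrices as Laplacian stresses\<close>

text \<open>Coefficients of a linear combination form a vector supported on \<open>J\<close>, which
  turns independence of the family into a kernel condition.\<close>

lemma independent_columns_iff:
  fixes M :: "real^'v^'v::finite"
  shows "independent_columns M J \<longleftrightarrow>
    (\<forall>z. (\<forall>x. x \<notin> J \<longrightarrow> z $ x = 0) \<longrightarrow> M *v z = 0 \<longrightarrow> z = 0)"
proof
  let ?f = "\<lambda>j. column j M"
  have mult: "M *v z = (\<Sum>j\<in>J. z $ j *\<^sub>R ?f j)" if "\<forall>x. x \<notin> J \<longrightarrow> z $ x = 0" for z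
    unfolding matrix_mult_sum scalar_mult_eq_scaleR using that by (intro sum.mono_neutral_right) auto
  {
    assume "independent_columns M J"
    then have inj: "inj_on ?f J" and ind: "independent (?f ` J)"
      by (simp_all add: independent_columns_def)
    show "\<forall>z. (\<forall>x. x \<notin> J \<longrightarrow> z $ x = 0) \<longrightarrow> M *v z = 0 \<longrightarrow> z = 0"
    proof (intro allI impI)
      fix z assume z: "\<forall>x. x \<notin> J \<longrightarrow> z $ x = 0" "M *v z = 0"
      \<comment> \<open>Dependence of a set attaches coefficients to vectors, not to indices;
        injectivity lets \<open>inv_into\<close> translate.\<close>
      let ?u = "\<lambda>v. z $ inv_into J ?f v"
      have inv: "?u (?f j) = z $ j" if "j \<in> J" for j
        by (subst inv_into_f_f[OF inj that]) (rule refl)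
      have "(\<Sum>v\<in>?f ` J. ?u v *\<^sub>R v) = (\<Sum>j\<in>J. z $ j *\<^sub>R ?f j)"
        unfolding sum.reindex[OF inj] o_def by (intro sum.cong refl) (simp only: inv)
      also have "\<dots> = 0" using z mult by simp
      finally have "\<forall>v\<in>?f ` J. ?u v = 0"
        using ind by (subst (asm) dependent_finite) auto
      then have "z $ j = 0" if "j \<in> J" for j
        using inv[OF that] that by auto
      with z(1) show "z = 0" by (auto simp: vec_eq_iff)
    qed
  next
    assume R: "\<forall>z. (\<forall>x. x \<notin> J \<longrightarrow> z $ x = 0) \<longrightarrow> M *v z = 0 \<longrightarrow> z = 0"
    have inj: "inj_on ?f J"
    proof (rule inj_onI)
      fix i j assume ij: "i \<in> J" "j \<in> J" "?f i = ?f j"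
      let ?z = "axis i 1 - axis j 1 :: real^'v"
      have "M *v ?z = 0"
        using ij(3) by (simp add: matrix_vector_mult_diff_distrib matrix_vector_mult_basis)
      moreover have "\<forall>x. x \<notin> J \<longrightarrow> ?z $ x = 0" using ij by (auto simp: axis_def)
      ultimately have "?z = 0" using R by blast
      then show "i = j" by (simp add: axis_eq_axis)
    qed
    moreover have "independent (?f ` J)"
    proof
      assume "dependent (?f ` J)"
      then obtain u where u: "\<exists>v\<in>?f ` J. u v \<noteq> 0" "(\<Sum>v\<in>?f ` J. u v *\<^sub>R v) = 0"
        by (subst (asm) dependent_finite) auto
      let ?z = "\<chi> j. if j \<in> J then u (?f j) else 0"
      have "M *v ?z = (\<Sum>j\<in>J. u (?f j) *\<^sub>R ?f j)"
        by (subst mult) auto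
      also have "\<dots> = 0" using u(2) inj by (simp add: sum.reindex)
      finally have "?z = 0" using R by simp
      then have "u (?f j) = 0" if "j \<in> J" for j
        using that by (simp add: vec_eq_iff) metis
      with u(1) show False by auto
    qed
    ultimately show "independent_columns M J" by (simp add: independent_columns_def)
  }
qed

lemma card_Compl_eq: "card (- A) = CARD('v) - card A" for A :: "'v::finite set"
  by (simp add: Compl_eq_Diff_UNIV card_Diff_subset)

text \<open>Sets of columns are traded for their complements \<open>X\<close>. The bound on
  \<open>d\<close> makes the truncated subtraction exact, so both descriptions range over the same
  sets.\<close>

lemma Gstr_iff:
  fixes M :: "real^'v^'v::finite"
  assumes "d + 1 \<le> CARD('v)"
  shows "M \<in> Gstr d E \<longleftrightarrow> transpose M = M \<and> (\<forall>i j. i \<noteq> j \<longrightarrow> {i, j} \<notin> E \<longrightarrow> M $ i $ j = 0) \<and>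
    M *v 1 = 0 \<and> rank M = CARD('v) - (d + 1) \<and>
    (\<forall>X z. card X = d + 1 \<longrightarrow> (\<forall>x\<in>X. z $ x = 0) \<longrightarrow> M *v z = 0 \<longrightarrow> z = 0)"
proof -
  have "(\<forall>J. card J = CARD('v) - (d + 1) \<longrightarrow> independent_columns M J) \<longleftrightarrow>
      (\<forall>X. card X = d + 1 \<longrightarrow> independent_columns M (- X))" (is "?l \<longleftrightarrow> ?r")
  proof
    assume ?l
    then show ?r by (simp add: card_Compl_eq)
  next
    assume r: ?r
    show ?l
    proof (intro allI impI)
      fix J :: "'v set" assume "card J = CARD('v) - (d + 1)"
      then have "card (- J) = d + 1" using assms by (simp add: card_Compl_eq)
      with r have "independent_columns M (- (- J))" by blast
      then show "independent_columns M J" by simp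
    qed
  qed
  then show ?thesis
    by (simp add: Gstr_def independent_columns_iff Ball_def)
qed

section \<open>Free rows and columns determine a stress matrix\<close>

lemma symmetric_matrix_inner:
  fixes M :: "real^'v^'v"
  assumes "transpose M = M"
  shows "(M *v x) \<bullet> y = x \<bullet> (M *v y)"
  by (metis assms dot_lmul_matrix vector_transpose_matrix)

text \<open>General position makes \<open>M\<close> injective on the vectors vanishing on
  \<open>S\<close>, and their space has dimension \<open>rank M\<close>; hence the free columns
  already span the range.\<close>

lemma Gstr_mult_support:
  fixes M :: "real^'v^'v::finite"
  assumes "M \<in> Gstr d E" "card S = d + 1"
  shows "\<exists>v. (\<forall>s\<in>S. v $ s = 0) \<and> M *v v = M *v u"
proof -
  let ?V = "{z :: real^'v. \<forall>s\<in>S. z $ s = 0}"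
  have d: "d + 1 \<le> CARD('v)" using assms(2) card_mono[of UNIV S] by simp
  note M = assms(1)[unfolded Gstr_iff[OF d]]
  have "inj_on ((*v) M) ?V"
  proof (rule inj_onI)
    fix x y assume xy: "x \<in> ?V" "y \<in> ?V" "M *v x = M *v y"
    then have "M *v (x - y) = 0" "\<forall>s\<in>S. (x - y) $ s = 0"
      by (simp_all add: matrix_vector_mult_diff_distrib)
    with M assms(2) have "x - y = 0" by blast
    then show "x = y" by simp
  qed
  then have "dim ((*v) M ` ?V) = dim ?V"
    using subspace_vanishing_on[of S] by (intro dim_image_eq matrix_vector_mul_linear) (simp add: span_eq_iff[THEN iffD2])
  also have "\<dots> = dim (range ((*v) M))"
    using M assms(2) by (simp add: dim_vanishing_on rank_dim_range)
  finally have "(*v) M ` ?V = range ((*v) M)"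
    by (intro subspace_dim_equal linear_subspace_image matrix_vector_mul_linear
        subspace_vanishing_on subspace_UNIV) auto
  then have "M *v u \<in> (*v) M ` ?V" by simp
  then show ?thesis by auto
qed

text \<open>The vector \<open>y = M *v z\<close> lives on \<open>S\<close>. With \<open>v\<close>
  vanishing on \<open>S\<close> and \<open>M *v v = M *v y\<close>, symmetry gives
  \<open>y \<bullet> y = y \<bullet> v\<close>, which is zero since the supports are
  disjoint.\<close>

lemma Gstr_kernel:
  fixes M :: "real^'v^'v::finite"
  assumes "M \<in> Gstr d E" "card S = d + 1" "\<And>t. t \<notin> S \<Longrightarrow> (M *v z) $ t = 0"
  shows "M *v z = 0"
proof -
  let ?y = "M *v z"
  have sym: "transpose M = M" using assms(1) by (simp add: Gstr_def)
  obtain v where v: "\<forall>s\<in>S. v $ s = 0" "M *v v = M *v ?y"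
    using Gstr_mult_support[OF assms(1,2)] by blast
  have "?y \<bullet> ?y = ?y \<bullet> v"
    using v(2) by (simp add: symmetric_matrix_inner[OF sym])
  also have "\<dots> = 0"
    unfolding inner_vec_def
  proof (intro sum.neutral ballI)
    fix i show "?y $ i \<bullet> v $ i = 0" using v(1) assms(3) by (cases "i \<in> S") auto
  qed
  finally show ?thesis by simp
qed

text \<open>Each \<open>M *v u\<close> equals \<open>M *v v\<close> with \<open>v\<close> vanishing
  on \<open>S\<close>. Then \<open>v - u\<close> is killed by the free rows, common to both
  matrices, hence by \<open>M'\<close>; and on \<open>v\<close> only the free columns act, which
  agree by symmetry.\<close>

lemma Gstr_eqI:
  fixes M M' :: "real^'v^'v::finite"
  assumes "M \<in> Gstr d E" "M' \<in> Gstr d E" "card S = d + 1"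
    and rows: "\<And>t j. t \<notin> S \<Longrightarrow> M $ t $ j = M' $ t $ j"
  shows "M = M'"
proof -
  have "M *v u = M' *v u" for u
  proof -
    obtain v where v: "\<forall>s\<in>S. v $ s = 0" "M *v v = M *v u"
      using Gstr_mult_support[OF assms(1,3)] by blast
    have row_eq: "(M *v z) $ t = (M' *v z) $ t" if "t \<notin> S" for z t
      by (simp add: matrix_vector_mult_def rows[OF that])
    have "(M *v (v - u)) $ t = 0" for t
      using v(2) by (simp add: matrix_vector_mult_diff_distrib)
    then have "M' *v (v - u) = 0"
      by (intro Gstr_kernel[OF assms(2,3)]) (simp add: row_eq[symmetric])
    then have 1: "M' *v v = M' *v u" by (simp add: matrix_vector_mult_diff_distrib)
    have sym: "M $ i $ j = M $ j $ i" "M' $ i $ j = M' $ j $ i" for i j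
      using assms(1,2) by (auto simp: Gstr_def transpose_def vec_eq_iff)
    have "M $ i $ t = M' $ i $ t" if "t \<notin> S" for i t
      using rows[OF that] sym by metis
    then have "M $ i $ j * v $ j = M' $ i $ j * v $ j" for i j
      using v(1) by (cases "j \<in> S") simp_all
    then have "M *v v = M' *v v" unfolding matrix_vector_mult_def by (simp only:)
    with 1 v(2) show ?thesis by simp
  qed
  then show ?thesis by (simp add: matrix_eq)
qed

text \<open>One endpoint lies off \<open>S\<close>; by symmetry the entry can be read from its row,
  and free rows are those of the Laplacian.\<close>

lemma stress_edge:
  assumes "nondegenerate F S w S" "\<not> (i \<in> S \<and> j \<in> S)" "i \<noteq> j"
  shows "stress F S w $ i $ j = - conductance F w i j"
proof -
  have det: "det (free_block F S w) \<noteq> 0" using assms(1) by (simp add: det_free_block)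
  have "stress F S w $ i $ j = stress F S w $ j $ i"
    using transpose_stress[OF det] by (auto simp: transpose_def vec_eq_iff)
  with assms(2,3) show ?thesis
    using stress_nth[OF det, of i j] stress_nth[OF det, of j i]
    by (cases "i \<in> S") (auto simp: laplacian_def conductance_sym)
qed

text \<open>The projection factor bounds the rank from above by the dimension of the space of
  vectors vanishing on \<open>S\<close>; injectivity on that space, from nondegeneracy at
  \<open>X = S\<close>, bounds it from below. A non-edge has an endpoint off the clique, so its
  entry is governed by the Laplacian.\<close>

lemma stress_in_Gstr:
  fixes E :: "'v::finite set set"
  assumes "nsets S 2 \<subseteq> E" "card S = d + 1"
    and nondeg: "\<And>X. card X = card S \<Longrightarrow> nondegenerate (E - nsets S 2) S w X"
  shows "stress (E - nsets S 2) S w \<in> Gstr d E"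
proof -
  define F where "F = E - nsets S 2"
  let ?M = "stress F S w"
  have d: "d + 1 \<le> CARD('v)" using assms(2) card_mono[of UNIV S] by simp
  have nd: "nondegenerate F S w S" using nondeg by (simp add: F_def)
  then have det: "det (free_block F S w) \<noteq> 0" by (simp add: det_free_block)
  have ker: "z = 0" if "card X = d + 1" "\<forall>x\<in>X. z $ x = 0" "?M *v z = 0" for X z
  proof -
    have "(laplacian F w *v z) $ t = (?M *v z) $ t" if "t \<notin> S" for t
      by (simp add: matrix_vector_mult_def stress_nth[OF det that])
    then show ?thesis
      using nondeg[of X] that assms(2) unfolding nondegenerate_def F_def[symmetric] by simp
  qed
  let ?V = "{z :: real^'v. \<forall>s\<in>S. z $ s = 0}"
  have dimV: "dim ?V = CARD('v) - (d + 1)" by (simp add: dim_vanishing_on assms(2))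
  have "rank ?M \<le> rank (coord_proj (- S) :: real^'v^'v)"
    unfolding stress_def by (rule order_trans[OF rank_mul_le_right rank_mul_le_left])
  also have "\<dots> \<le> dim ?V"
    unfolding rank_dim_range by (intro dim_subset) (auto simp: coord_proj_mult_nth)
  finally have "rank ?M \<le> dim ?V" .
  moreover have "dim ?V \<le> rank ?M"
  proof -
    have "inj_on ((*v) ?M) ?V"
    proof (rule inj_onI)
      fix x y assume xy: "x \<in> ?V" "y \<in> ?V" "?M *v x = ?M *v y"
      then have "?M *v (x - y) = 0" "\<forall>s\<in>S. (x - y) $ s = 0"
        by (simp_all add: matrix_vector_mult_diff_distrib)
      then have "x - y = 0" using ker assms(2) by blast
      then show "x = y" by simp
    qed
    then have "dim ((*v) ?M ` ?V) = dim ?V"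
      using subspace_vanishing_on[of S] by (intro dim_image_eq matrix_vector_mul_linear) (simp add: span_eq_iff[THEN iffD2])
    then show ?thesis
      using dim_subset[OF image_mono[OF subset_UNIV], of "(*v) ?M" ?V] by (simp add: rank_dim_range)
  qed
  ultimately have "rank ?M = CARD('v) - (d + 1)" using dimV by simp
  moreover have "?M $ i $ j = 0" if "i \<noteq> j" "{i, j} \<notin> E" for i j
  proof -
    have "\<not> (i \<in> S \<and> j \<in> S)"
      using that assms(1) doubleton_in_nsets_2[of i j S] by blast
    moreover have "{i, j} \<notin> F" using that by (simp add: F_def)
    ultimately show ?thesis
      using that(1) stress_edge[OF nd, of i j] by (simp add: conductance_def)
  qed
  moreover have "?M *v 1 = 0"
    by (simp add: stress_def matrix_vector_mul_assoc[symmetric] laplacian_mult_one)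
  ultimately have "?M \<in> Gstr d E"
    using ker transpose_stress[OF det] by (simp add: Gstr_iff[OF d])
  then show ?thesis by (simp add: F_def)
qed

text \<open>Averaging over both orders of the endpoints of an edge avoids choosing one.\<close>

definition edge_weights :: "'v set set \<Rightarrow> real^'v^'v \<Rightarrow> real^('v::finite set)" where
  "edge_weights F M = (\<chi> e. if e \<in> F then - (\<Sum>i\<in>e. \<Sum>j\<in>e - {i}. M $ i $ j) / 2 else 0)"

lemma edge_weights_nth:
  assumes "i \<noteq> j"
  shows "edge_weights F M $ {i, j} = (if {i, j} \<in> F then - (M $ i $ j + M $ j $ i) / 2 else 0)"
  using assms by (simp add: edge_weights_def insert_Diff_if)

lemma edge_weights_in_weight_space: "edge_weights F M \<in> weight_space F"
  by (simp add: edge_weights_def weight_space_def)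

lemma linear_edge_weights: "linear (edge_weights F)"
  by (rule linearI) (auto simp: edge_weights_def vec_eq_iff sum.distrib sum_distrib_left add_divide_distrib)

lemma edge_weights_eqI:
  assumes "F \<subseteq> nsets UNIV 2" "w \<in> weight_space F"
    and "\<And>i j. i \<noteq> j \<Longrightarrow> {i, j} \<in> F \<Longrightarrow> M $ i $ j = - w $ {i, j}"
  shows "edge_weights F M = w"
  unfolding vec_eq_iff
proof
  fix e
  show "edge_weights F M $ e = w $ e"
  proof (cases "e \<in> F")
    case True
    then obtain i j where ij: "e = {i, j}" "i \<noteq> j" using assms(1) by (blast elim: nsets2_E)
    then show ?thesis
      using assms(3)[of i j] assms(3)[of j i] True by (simp add: edge_weights_nth insert_commute)
  next
    case False
    then show ?thesis using assms(2) by (simp add: edge_weights_def weight_space_def)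
  qed
qed

text \<open>An edge at a vertex \<open>t\<close> off \<open>S\<close> never lies in the clique, so
  its weight is retained; the diagonal entry is then forced by the zero row sum of
  \<open>M\<close>.\<close>

lemma laplacian_edge_weights:
  assumes "M \<in> Gstr d E" "t \<notin> S"
  shows "laplacian (E - nsets S 2) (edge_weights (E - nsets S 2) M) $ t $ j = M $ t $ j"
proof -
  let ?F = "E - nsets S 2"
  have sym: "M $ i $ j = M $ j $ i" for i j
    using assms(1) by (auto simp: Gstr_def transpose_def vec_eq_iff)
  have cond: "conductance ?F (edge_weights ?F M) t k = - M $ t $ k" if "t \<noteq> k" for k
  proof (cases "{t, k} \<in> E")
    case True
    then have "{t, k} \<in> ?F" using assms(2) by (auto simp: that)
    then show ?thesis using that sym[of k t] by (simp add: conductance_def edge_weights_nth)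
  next
    case False
    then show ?thesis using that assms(1) by (simp add: conductance_def Gstr_def)
  qed
  have "(M *v 1) $ t = 0" using assms(1) by (simp add: Gstr_def)
  then have "M $ t $ t + (\<Sum>k\<in>- {t}. M $ t $ k) = 0"
    by (simp add: matrix_vector_mult_def Compl_eq_Diff_UNIV sum.remove[of UNIV t])
  moreover have "(\<Sum>k\<in>UNIV. conductance ?F (edge_weights ?F M) t k) = (\<Sum>k\<in>- {t}. - M $ t $ k)"
    by (rule sum.mono_neutral_cong_right) (auto simp: cond)
  ultimately show ?thesis
    using cond[of j] by (auto simp: laplacian_def sum_negf)
qed

text \<open>A vector killed by the free rows of \<open>M\<close> is killed by all of
  \<open>M\<close>, so general position of \<open>M\<close> becomes nondegeneracy of its
  weights.\<close>

lemma edge_weights_nondegenerate: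
  fixes E :: "'v::finite set set"
  assumes "M \<in> Gstr d E" "card S = d + 1" "card X = card S"
  shows "nondegenerate (E - nsets S 2) S (edge_weights (E - nsets S 2) M) X"
  unfolding nondegenerate_def
proof (intro allI impI)
  let ?F = "E - nsets S 2"
  fix z assume z: "\<forall>x\<in>X. z $ x = 0"
    "\<forall>t. t \<notin> S \<longrightarrow> (laplacian ?F (edge_weights ?F M) *v z) $ t = 0"
  have d: "d + 1 \<le> CARD('v)" using assms(2) card_mono[of UNIV S] by simp
  have "M *v z = 0"
    using z(2) by (intro Gstr_kernel[OF assms(1,2)])
      (simp add: matrix_vector_mult_def laplacian_edge_weights[OF assms(1)])
  then show "z = 0" using assms z(1) by (simp add: Gstr_iff[OF d])
qed

section \<open>Images of rational maps\<close>

lemma zariski_closure_subset: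
  "algebraic_set A \<Longrightarrow> S \<subseteq> A \<Longrightarrow> zariski_closure S \<subseteq> A"
  by (auto simp: zariski_closure_def)

lemma zariski_closure_superset: "S \<subseteq> zariski_closure S"
  by (auto simp: zariski_closure_def)

lemma smooth_map_on_imp_continuous_on: "smooth_map_on S f \<Longrightarrow> continuous_on S f"
  unfolding smooth_map_on_def by (metis times_differentiable_on.simps(1))

text \<open>If two proper algebraic subsets covered the closure, each would have a polynomial
  vanishing on it but not on the whole image, and its pull-back would have a non-zero numerator. At
  a point of \<open>W\<close> where both numerators and \<open>h\<close> are non-zero, the image
  lies in neither subset.\<close>

lemma irreducible_rational_image:
  fixes \<rho> :: "'a::euclidean_space \<Rightarrow> 'b::euclidean_space"
  assumes W: "subspace W" and h: "real_polynomial_function h"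
    and U: "U = {w\<in>W. h w \<noteq> 0}" and \<rho>: "rational_map_on U \<rho>"
  shows "irreducible_semialgebraic (\<rho> ` U)"
  unfolding irreducible_semialgebraic_def irreducible_algebraic_def
proof
  let ?Z = "zariski_closure (\<rho> ` U)"
  assume "\<exists>B C. algebraic_set B \<and> algebraic_set C \<and> B \<subset> ?Z \<and> C \<subset> ?Z \<and> ?Z = B \<union> C"
  then obtain B C where BC: "algebraic_set B" "algebraic_set C" "B \<subset> ?Z" "C \<subset> ?Z" "?Z = B \<union> C"
    by blast
  have witness: "\<exists>(f :: 'b \<Rightarrow> real) p. real_polynomial_function p \<and>
      (\<forall>x\<in>A. f x = 0) \<and> (\<forall>w\<in>U. f (\<rho> w) = 0 \<longrightarrow> p w = 0) \<and> (\<exists>a\<in>W. p a \<noteq> 0)"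
    if A: "algebraic_set A" "A \<subset> ?Z" for A
  proof -
    obtain F where F: "\<forall>f\<in>F. real_polynomial_function f" "A = {x. \<forall>f\<in>F. f x = 0}"
      using A(1) by (auto simp: algebraic_set_def)
    have "\<not> \<rho> ` U \<subseteq> A" using zariski_closure_subset[OF A(1)] A(2) by blast
    then obtain a f where af: "a \<in> U" "f \<in> F" "f (\<rho> a) \<noteq> 0" using F(2) by blast
    have poly_f: "real_polynomial_function f" using F(1) af(2) by blast
    obtain p q where pq: "real_polynomial_function p" "real_polynomial_function q"
      "\<And>w. w \<in> U \<Longrightarrow> q w \<noteq> 0" "\<And>w. w \<in> U \<Longrightarrow> f (\<rho> w) = p w / q w"
      by (rule rational_function_onE[OF rational_function_on_polynomial_compose[OF poly_f \<rho>]])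
        (rule that; assumption)
    have "p a \<noteq> 0" using pq(4)[OF af(1)] af(3) by auto
    moreover have "\<forall>w\<in>U. f (\<rho> w) = 0 \<longrightarrow> p w = 0" using pq(3,4) by simp
    moreover have "a \<in> W" using af(1) U by simp
    moreover have "\<forall>x\<in>A. f x = 0" using F(2) af(2) by blast
    ultimately show ?thesis
      using pq(1) by (intro exI[of _ f] exI[of _ p] conjI bexI[where x = a])
  qed
  obtain f :: "'b \<Rightarrow> real" and p a where f: "real_polynomial_function p" "\<forall>x\<in>B. f x = 0"
    "\<forall>w\<in>U. f (\<rho> w) = 0 \<longrightarrow> p w = 0" "a \<in> W" "p a \<noteq> 0"
    using witness[OF BC(1,3)] by (elim exE conjE bexE) (rule that; assumption)
  obtain g :: "'b \<Rightarrow> real" and q b where g: "real_polynomial_function q" "\<forall>x\<in>C. g x = 0"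
    "\<forall>w\<in>U. g (\<rho> w) = 0 \<longrightarrow> q w = 0" "b \<in> W" "q b \<noteq> 0"
    using witness[OF BC(2,4)] by (elim exE conjE bexE) (rule that; assumption)
  obtain c where c: "c \<in> W" "p c \<noteq> 0" "q c \<noteq> 0"
    by (rule common_nonzero_on_subspace[OF W f(1) g(1) f(4,5) g(4,5)])
  \<comment> \<open>An empty image would have its closure inside \<open>B\<close>. Hence
    \<open>h\<close> is non-zero somewhere on \<open>W\<close>, as the choice of \<open>v\<close>
    requires.\<close>
  have "U \<noteq> {}" using zariski_closure_subset[OF BC(1), of "\<rho> ` U"] BC(3) by blast
  then obtain u where u: "u \<in> W" "h u \<noteq> 0" using U by blast
  have "real_polynomial_function (\<lambda>x. p x * q x)" using f(1) g(1) by (rule real_polynomial_function.intros(4))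
  moreover have "p c * q c \<noteq> 0" using c by simp
  ultimately obtain v where v: "v \<in> W" "p v * q v \<noteq> 0" "h v \<noteq> 0"
    using common_nonzero_on_subspace[where p = "\<lambda>x. p x * q x" and q = h, OF W _ h c(1) _ u] by metis
  then have "v \<in> U" using U by simp
  then have "\<rho> v \<in> B \<union> C" using zariski_closure_superset[of "\<rho> ` U"] BC(5) by blast
  then have "f (\<rho> v) = 0 \<or> g (\<rho> v) = 0" using f(2) g(2) by blast
  then have "p v = 0 \<or> q v = 0" using f(3) g(3) \<open>v \<in> U\<close> by blast
  with v(2) show False by auto
qed

text \<open>
  With its linear left inverse, the rational map parameterizes a graph over U; the shear
  M - \<rho> (\<pi> M) + \<iota> (\<pi> M) flattens it.
\<close>

lemma smooth_submanifold_rational_image: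
  fixes \<rho> :: "'a::euclidean_space \<Rightarrow> 'b::euclidean_space"
  assumes W: "subspace W" and h: "real_polynomial_function h"
    and U: "U = {w\<in>W. h w \<noteq> 0}" and \<rho>: "rational_map_on U \<rho>"
    and \<pi>: "linear \<pi>" "\<And>M. \<pi> M \<in> W" "\<And>w. w \<in> U \<Longrightarrow> \<pi> (\<rho> w) = w"
    and \<iota>: "linear \<iota>" "\<And>w. w \<in> W \<Longrightarrow> \<pi> (\<iota> w) = w"
  shows "smooth_submanifold (dim W) (\<rho> ` U)"
proof -
  \<comment> \<open>The open set of points that \<open>\<pi>\<close> sends into \<open>U\<close>; it
    contains the whole image, so a single chart serves every point.\<close>
  define V where "V = {M. h (\<pi> M) \<noteq> 0}"
  define \<phi> where "\<phi> M = M - \<rho> (\<pi> M) + \<iota> (\<pi> M)" for M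
  define \<psi> where "\<psi> M = M + \<rho> (\<pi> M) - \<iota> (\<pi> M)" for M
  have V_iff: "M \<in> V \<longleftrightarrow> \<pi> M \<in> U" for M using \<pi>(2) by (simp add: V_def U)
  have poly_\<pi>: "polynomial_function \<pi>"
    using \<pi>(1) by (intro polynomial_function_bounded_linear linear_conv_bounded_linear[THEN iffD1])
  have poly_\<iota>\<pi>: "polynomial_function (\<lambda>M. \<iota> (\<pi> M))"
    using linear_compose[OF \<pi>(1) \<iota>(1)]
    by (intro polynomial_function_bounded_linear linear_conv_bounded_linear[THEN iffD1]) (simp add: o_def)
  have "continuous_on UNIV (\<lambda>M. h (\<pi> M))"
    using real_polynomial_function_compose'[OF poly_\<pi> h]
    by (simp add: continuous_on_polymonial_function real_polynomial_function_eq)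
  then have "open V" unfolding V_def by (intro open_Collect_neq) auto
  have "\<pi> ` V \<subseteq> U" using V_iff by blast
  then have rat: "rational_map_on V (\<lambda>M. \<rho> (\<pi> M))"
    by (rule rational_map_on_compose_polynomial[OF \<rho> poly_\<pi>])
  have smooth: "smooth_map_on V \<phi>" "smooth_map_on V \<psi>"
    unfolding \<phi>_def[abs_def] \<psi>_def[abs_def]
    by (intro rational_map_on_smooth \<open>open V\<close> rational_map_on_add rational_map_on_diff rat
        rational_map_on_polynomial poly_\<iota>\<pi> polynomial_function_id)+
  \<comment> \<open>Over \<open>U\<close> both \<open>\<rho>\<close> and \<open>\<iota>\<close> are
    sections of \<open>\<pi>\<close>, so the two shears preserve the value of \<open>\<pi>\<close>
    and therefore undo each other.\<close>
  have \<pi>_\<phi>: "\<pi> (\<phi> M) = \<pi> M" and \<pi>_\<psi>: "\<pi> (\<psi> M) = \<pi> M" if "M \<in> V" for M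
    using that V_iff \<pi> \<iota> by (simp_all add: \<phi>_def \<psi>_def linear_add linear_diff)
  have hom: "homeomorphism V V \<phi> \<psi>"
  proof (rule homeomorphismI)
    show "continuous_on V \<phi>" "continuous_on V \<psi>"
      by (intro smooth_map_on_imp_continuous_on smooth)+
    show "\<phi> ` V \<subseteq> V" "\<psi> ` V \<subseteq> V" using \<pi>_\<phi> \<pi>_\<psi> V_iff by auto
    show "\<psi> (\<phi> M) = M" if "M \<in> V" for M
      using \<pi>_\<phi>[OF that] by (simp add: \<psi>_def) (simp add: \<phi>_def)
    show "\<phi> (\<psi> M) = M" if "M \<in> V" for M
      using \<pi>_\<psi>[OF that] by (simp add: \<phi>_def) (simp add: \<psi>_def)
  qed
  have sub: "\<rho> ` U \<subseteq> V" using \<pi>(3) V_iff by auto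
  have "\<phi> ` (V \<inter> \<rho> ` U) = V \<inter> \<iota> ` W"
  proof
    show "\<phi> ` (V \<inter> \<rho> ` U) \<subseteq> V \<inter> \<iota> ` W"
    proof
      fix y assume "y \<in> \<phi> ` (V \<inter> \<rho> ` U)"
      then obtain w where w: "w \<in> U" "\<rho> w \<in> V" "y = \<phi> (\<rho> w)" by blast
      have "y = \<iota> w" using w \<pi>(3) by (simp add: \<phi>_def)
      moreover have "\<iota> w \<in> V" using w(1) V_iff \<iota>(2) U by simp
      ultimately show "y \<in> V \<inter> \<iota> ` W" using w(1) U by auto
    qed
    show "V \<inter> \<iota> ` W \<subseteq> \<phi> ` (V \<inter> \<rho> ` U)"
    proof
      fix y assume "y \<in> V \<inter> \<iota> ` W"
      then obtain w where w: "w \<in> W" "y = \<iota> w" "\<iota> w \<in> V" by blast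
      then have "w \<in> U" using V_iff \<iota>(2) by simp
      moreover from this have "\<phi> (\<rho> w) = y" using \<pi>(3) w by (simp add: \<phi>_def)
      ultimately show "y \<in> \<phi> ` (V \<inter> \<rho> ` U)" using sub by blast
    qed
  qed
  moreover have "subspace (\<iota> ` W)" using \<iota>(1) W by (rule linear_subspace_image)
  moreover have "dim (\<iota> ` W) = dim W"
  proof (rule dim_image_eq[OF \<iota>(1)])
    show "inj_on \<iota> (span W)"
      by (metis W \<iota>(2) inj_on_inverseI span_eq_iff)
  qed
  ultimately show ?thesis
    unfolding smooth_submanifold_def using hom smooth sub
    by (intro ballI exI[of _ V] exI[of _ "\<iota> ` W"] exI[of _ \<phi>] exI[of _ \<psi>]) auto
qed

text \<open>An inverse slice chart followed by \<open>\<pi>\<close> is a continuous injection of a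
  nonempty open subset of a \<open>t\<close>-dimensional subspace into \<open>W\<close>; invariance
  of domain then bounds \<open>t\<close>.\<close>

lemma has_open_submanifold_le:
  fixes \<pi> :: "'b::euclidean_space \<Rightarrow> 'a::euclidean_space"
  assumes "has_open_submanifold G t" "subspace W"
    and "continuous_on UNIV \<pi>" "\<And>M. M \<in> G \<Longrightarrow> \<pi> M \<in> W" "inj_on \<pi> G"
  shows "t \<le> dim W"
proof -
  obtain M where M: "M \<noteq> {}" "openin (top_of_set G) M" "smooth_submanifold t M"
    using assms(1) by (auto simp: has_open_submanifold_def)
  then obtain p where p: "p \<in> M" by blast
  obtain X Y L \<phi> \<psi> where c: "p \<in> X" "homeomorphism X (Y :: 'b set) \<phi> \<psi>" "smooth_map_on Y \<psi>"
    "subspace L" "dim L = t" "\<phi> ` (X \<inter> M) = Y \<inter> L"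
    using M(3)[unfolded smooth_submanifold_def, rule_format, OF p]
    by (elim exE conjE) (rule that; assumption)
  have "open Y" using c(3) by (simp add: smooth_map_on_def)
  have MG: "M \<subseteq> G" using M(2) openin_imp_subset by blast
  have back_in: "\<psi> y \<in> G" if "y \<in> Y \<inter> L" for y
  proof -
    have "y \<in> \<phi> ` (X \<inter> M)" using that c(6) by simp
    then obtain x where x: "x \<in> X" "x \<in> M" "y = \<phi> x" by blast
    then show ?thesis using homeomorphism_apply1[OF c(2) x(1)] MG by (simp add: subsetD)
  qed
  have "dim L \<le> dim W"
  proof (rule invariance_of_dimension_subspaces)
    show "openin (top_of_set L) (Y \<inter> L)"
      using \<open>open Y\<close> by (auto simp: openin_open)
    show "continuous_on (Y \<inter> L) (\<pi> \<circ> \<psi>)"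
    proof (rule continuous_on_compose)
      show "continuous_on (Y \<inter> L) \<psi>"
        by (rule continuous_on_subset[OF homeomorphism_cont2[OF c(2)]]) simp
      show "continuous_on (\<psi> ` (Y \<inter> L)) \<pi>"
        by (rule continuous_on_subset[OF assms(3)]) simp
    qed
    show "\<pi> \<circ> \<psi> \<in> Y \<inter> L \<rightarrow> W" using back_in assms(4) by auto
    show "inj_on (\<pi> \<circ> \<psi>) (Y \<inter> L)"
    proof (rule comp_inj_on)
      show "inj_on \<psi> (Y \<inter> L)"
        by (rule inj_on_inverseI[of _ \<phi>]) (simp add: homeomorphism_apply2[OF c(2)])
      show "inj_on \<pi> (\<psi> ` (Y \<inter> L))"
        by (rule inj_on_subset[OF assms(5)]) (rule image_subsetI, rule back_in)
    qed
    show "Y \<inter> L \<noteq> {}"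
      unfolding c(6)[symmetric] using c(1) p by blast
  qed (use c assms in auto)
  with c(5) show ?thesis by simp
qed

section \<open>Dimension of the weight space\<close>

lemma subspace_weight_space: "subspace (weight_space F)"
  by (auto simp: weight_space_def subspace_def)

lemma dim_weight_space: "dim (weight_space F) = card F"
  using dim_substandard_cart[of F, where 'a = real] by (simp add: weight_space_def dim_vec_eq)

lemma card_nsets: "finite A \<Longrightarrow> card (nsets A k) = card A choose k"
  by (simp add: nsets_def n_subsets finite_subset cong: conj_cong)

section \<open>The parameterization\<close>

theorem theorem1p1:
  fixes E :: "'v::finite set set" and S :: "'v set" and d :: nat
  assumes "d \<ge> 1"
    and "simple_graph E"
    and "k_connected (d + 1) E"
    and "card S = d + 1"
    and "nsets S 2 \<subseteq> E"
  shows "irreducible_semialgebraic (Gstr d E) \<and>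
    has_semialgebraic_dim (Gstr d E) (card E - ((d + 1) choose 2)) \<and>
    dim (weight_space (E - nsets S 2)) = card E - ((d + 1) choose 2) \<and>
    (\<exists>U (\<rho> :: real^('v set) \<Rightarrow> real^'v^'v).
       zariski_open_in (weight_space (E - nsets S 2)) U \<and>
       rational_map_on U \<rho> \<and>
       \<rho> ` U = Gstr d E \<and>
       (\<forall>w\<in>U. \<forall>i j. {i, j} \<in> E - nsets S 2 \<longrightarrow> edge_weight (\<rho> w) i j = w $ {i, j}))"
proof -
  define F where "F = E - nsets S 2"
  \<comment> \<open>The sets of \<open>d + 1\<close> columns to delete. \<open>S\<close> is one of
    them, which secures the invertibility of the free block.\<close>
  define \<X> where "\<X> = {X :: 'v set. card X = card S}"
  define U where "U = {w \<in> weight_space F. \<forall>X\<in>\<X>. nondegenerate F S w X}"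
  have F_simple: "F \<subseteq> nsets UNIV 2" using assms(2) by (auto simp: F_def simple_graph_def)
  have F_edge: "i \<noteq> j \<and> \<not> (i \<in> S \<and> j \<in> S)" if "{i, j} \<in> F" for i j
    using that F_simple doubleton_in_nsets_2[of i j S] doubleton_in_nsets_2[of i j UNIV]
    unfolding F_def by blast
  obtain p where p: "\<And>X. X \<in> \<X> \<Longrightarrow> real_polynomial_function (p X)"
    "\<And>X w. X \<in> \<X> \<Longrightarrow> nondegenerate F S w X \<longleftrightarrow> p X w \<noteq> 0"
    using ex_nondegenerate_polynomial[of _ S F] unfolding \<X>_def mem_Collect_eq by metis
  \<comment> \<open>The product condenses all minors into one polynomial, so that \<open>U\<close>
    is the complement of a single hypersurface in the weight space.\<close>
  define h where "h w = (\<Prod>X\<in>\<X>. p X w)" for w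
  have h: "real_polynomial_function h"
    unfolding h_def[abs_def] using p(1) by (intro real_polynomial_function_prod) auto
  have U: "U = {w \<in> weight_space F. h w \<noteq> 0}"
    using p(2) by (auto simp: U_def h_def)
  have "\<exists>w\<in>weight_space F. h w \<noteq> 0"
    unfolding h_def
  \<comment> \<open>Each minor is non-zero at weights that depend on \<open>X\<close>; a subspace
    being irreducible, common weights exist.\<close>
  proof (rule prod_nonzero_on_subspace[OF subspace_weight_space])
    show "\<exists>w\<in>weight_space F. p X w \<noteq> 0" if "X \<in> \<X>" for X
      using ex_nondegenerate[OF assms(2,3,4), of X] p(2)[OF that] that assms(4)
      by (auto simp: F_def \<X>_def)
  qed (use p(1) in auto)
  then have "U \<noteq> {}" using U by blast
  have nondegS: "nondegenerate F S w S" if "w \<in> U" for w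
    using that by (auto simp: U_def \<X>_def)
  have stress_F: "stress F S w $ i $ j = - w $ {i, j}" if "w \<in> U" "{i, j} \<in> F" for w i j
    using F_edge[OF that(2)] stress_edge[OF nondegS[OF that(1)], of i j] that(2)
    by (simp add: conductance_def)
  have weights_stress: "edge_weights F (stress F S w) = w" if "w \<in> U" for w
    using that stress_F[OF that] by (intro edge_weights_eqI[OF F_simple]) (auto simp: U_def)
  have stress_Gstr: "stress F S w \<in> Gstr d E" if "w \<in> U" for w
    using that stress_in_Gstr[OF assms(5,4)] by (simp add: U_def \<X>_def F_def)
  have weights_U: "edge_weights F M \<in> U" if "M \<in> Gstr d E" for M
    using edge_weights_nondegenerate[OF that assms(4)] edge_weights_in_weight_space
    by (simp add: U_def \<X>_def F_def)
  have stress_weights: "stress F S (edge_weights F M) = M" if "M \<in> Gstr d E" for M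
  \<comment> \<open>Both sides are general position stress matrices with the same free rows.\<close>
  proof (rule Gstr_eqI[OF stress_Gstr[OF weights_U[OF that]] that assms(4)])
    fix t j assume "t \<notin> S"
    with nondegS[OF weights_U[OF that]] show "stress F S (edge_weights F M) $ t $ j = M $ t $ j"
      by (simp add: stress_nth det_free_block) (simp add: F_def laplacian_edge_weights[OF that])
  qed
  have image: "stress F S ` U = Gstr d E"
  proof
    show "stress F S ` U \<subseteq> Gstr d E" using stress_Gstr by (rule image_subsetI)
    show "Gstr d E \<subseteq> stress F S ` U"
      using stress_weights[symmetric] weights_U by (intro subsetI) (rule image_eqI)
  qed
  have rat: "rational_map_on U (stress F S)"
    by (intro rational_map_on_stress) (simp add: det_free_block nondegS)
  have "irreducible_semialgebraic (Gstr d E)"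
    using irreducible_rational_image[OF subspace_weight_space h U rat] by (simp add: image)
  moreover have dimW: "dim (weight_space F) = card E - ((d + 1) choose 2)"
    using assms(4,5) by (simp add: dim_weight_space F_def card_Diff_subset card_nsets finite_subset)
  moreover have "has_semialgebraic_dim (Gstr d E) (dim (weight_space F))"
    unfolding has_semialgebraic_dim_def
  proof (intro conjI allI impI)
    \<comment> \<open>A linear section of \<open>edge_weights F\<close> by matrices with zero
      diagonal. Its values need not be stress matrices: it only supplies the subspace onto which the
      chart flattens \<open>Gstr d E\<close>.\<close>
    let ?\<iota> = "\<lambda>w. \<chi> i j. - conductance F w i j"
    have "linear ?\<iota>"
      by (rule linearI) (auto simp: conductance_def vec_eq_iff)
    moreover have "edge_weights F (?\<iota> w) = w" if "w \<in> weight_space F" for w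
      using that by (intro edge_weights_eqI[OF F_simple]) (auto simp: conductance_def)
    ultimately have "smooth_submanifold (dim (weight_space F)) (Gstr d E)"
      using smooth_submanifold_rational_image[OF subspace_weight_space h U rat linear_edge_weights
          edge_weights_in_weight_space weights_stress, of ?\<iota>] by (simp add: image)
    moreover have "Gstr d E \<noteq> {}" using \<open>U \<noteq> {}\<close> by (simp add: image[symmetric])
    ultimately show "has_open_submanifold (Gstr d E) (dim (weight_space F))"
      unfolding has_open_submanifold_def by (intro exI[of _ "Gstr d E"] conjI openin_subtopology_self)
    fix t assume "has_open_submanifold (Gstr d E) t"
    then show "t \<le> dim (weight_space F)"
    \<comment> \<open>The projection is the linear map \<open>edge_weights F\<close>, injective on
      the stress matrices because \<open>stress F S\<close> recovers each matrix from its
      weights.\<close>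
    proof (rule has_open_submanifold_le[OF _ subspace_weight_space])
      show "continuous_on UNIV (edge_weights F)"
        by (rule linear_continuous_on[OF linear_conv_bounded_linear[THEN iffD1, OF linear_edge_weights]])
      show "inj_on (edge_weights F) (Gstr d E)"
        by (rule inj_on_inverseI) (rule stress_weights)
    qed (rule edge_weights_in_weight_space)
  qed
  moreover have "zariski_open_in (weight_space F) U"
    unfolding zariski_open_in_def
  proof (intro exI conjI)
    show "algebraic_set {w. h w = 0}"
      unfolding algebraic_set_def using h by (intro exI[of _ "{h}"]) auto
    show "U = weight_space F - {w. h w = 0}" using U by auto
  qed
  moreover have "edge_weight (stress F S w) i j = w $ {i, j}" if "w \<in> U" "{i, j} \<in> F" for w i j
    using stress_F[OF that] by (simp add: edge_weight_def)
  ultimately show ?thesis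
    using image rat unfolding F_def by metis
qed

end
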